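(* Let $N\ge3$ be odd, $K>0$, and let $z$ be in the interior of $\mathcal A_{\mathrm{regular}}$. If the leafwise measure is $m_z=m_{\mathrm{KKS},z}$, the normalized Liouville (KKS) measure on the coadjoint orbit $\mathcal O^*(z)$, then the leafwise averaged energy and enstrophy fluxes both vanish: $$\overline\Pi_{\mathcal E}(K;z)=\overline\Pi_{\mathcal Z}(K;z)=0,$$ where $\overline\Pi_{\mathcal E}(K;z)=\int_{\mathcal O^*(z)}\Pi_{\mathcal E}(K;\Omega)\,dm_z(\Omega)$ and $\overline\Pi_{\mathcal Z}(K;z)=\int_{\mathcal O^*(z)}\Pi_{\mathcal Z}(K;\Omega)\,dm_z(\Omega)$.
   Context: $\mathfrak{su}(N)$ is the real Lie algebra of trace-zero anti-Hermitian complex $N\times N$ matrices, $[A,B]=AB-BA$, with inner product $(A,B)=-\operatorname{tr}(AB)$. Put $\omega_N=e^{-4\pi i/N}$, $F=\mathrm{diag}(1,\omega_N,\dots,\omega_N^{N-1})$, and $H$ the matrix with $H_{j,j+1}=1$ ($1\le j\le N-1$), $H_{N,1}=1$, other entries $0$. $\mathcal K_N=(\mathbb Z/N\mathbb Z)^2\setminus\{(0,0)\}$; each $k\in\mathcal K_N$ is identified with its representative with $k_1,k_2\in\{-\frac{N-1}2,\dots,\frac{N-1}2\}$ and $|k|$ is its Euclidean norm. $J_k=\omega_N^{k_1k_2/2}F^{k_1}H^{k_2}$ (with $k_1k_2/2:=2^{-1}k_1k_2$ in $\mathbb Z/N\mathbb Z$), $L_{k,N}=\frac{N}{4\pi i}J_k$,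 a basis of the complexification of $\mathfrak{su}(N)$. Every $\Omega\in\mathfrak{su}(N)$ is $\Omega=\sum_{k\in\mathcal K_N}\Omega_kL_{k,N}$ with $\Omega_k\in\mathbb C$. The operator $A$, $AL_{k,N}=|k|^2L_{k,N}$, preserves $\mathfrak{su}(N)$; $\Psi=-A^{-1}\Omega$. $\pi(\Omega)=(\operatorname{tr}\Omega^2,\dots,\operatorname{tr}\Omega^N)$, $\mathcal A=\pi(\mathfrak{su}(N))$ (a subset of a real vector space of dimension $N-1$, since $\operatorname{tr}\Omega^k\in i^k\mathbb R$); for $z\in\mathcal A$, $\mathcal O^*(z)=\pi^{-1}(z)$ is a single coadjoint orbit $\{g\Lambda g^{-1}:g\in SU(N)\}$. $\mathcal A_{\mathrm{regular}}$ is the set of $z\in\mathcal A$ for which elements of $\mathcal O^*(z)$ have $N$ distinct eigenvalues. The KKS symplectic form on the orbit is $\omega_{\mathrm{KKS}}([X,\Omega],[Y,\Omega])=(\Omega,[X,Y])$; $m_{\mathrm{KKS},z}$ is the associated Liouville volume normalized to a probability measure (equivalently, the push-forward of normalized Haar measure on $SU(N)$ under $g\mapsto g\Lambda g^{-1}$). $\mathcal E_{\le K}(\Omega)=\frac12\sum_{k\in\mathcal K_N,|k|\le K}\frac{|\Omega_k|^2}{|k|^2}$, $\mathcal Z_{\le K}(\Omega)=\frac12\sum_{k\in\mathcal K_N,|k|\le K}|\Omega_k|^2$; with $D$ the Fréchet derivative, $\Pi_{\mathcal E}(K;\Omega)=-[D\mathcal E_{\le K}(\Omega)]([\Psi,\Omega])$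 and $\Pi_{\mathcal Z}(K;\Omega)=-[D\mathcal Z_{\le K}(\Omega)]([\Psi,\Omega])$. *)

theory Defs
  imports "HOL-Analysis.Analysis" "HOL-Probability.Probability_Measure"
begin

section \<open>Matrices and the Lie algebra \<open>su(N)\<close>\<close>

text \<open>The size is \<open>N = CARD('n)\<close>.  The linear order on the index type \<open>'n\<close> identifies it with
  \<open>{1..N}\<close>: the index \<open>i\<close> stands for its rank.\<close>

type_synonym 'n cmat = "((complex, 'n) vec, 'n) vec"

definition pos :: "'n::{finite,linorder} \<Rightarrow> nat" where
  "pos i = card {..i}"

definition cscale :: "complex \<Rightarrow> 'n::finite cmat \<Rightarrow> 'n cmat" (infixr "*\<^sub>C" 75) where
  "c *\<^sub>C A = map_matrix ((*) c) A"

text \<open>The power \<open>A ^ k\<close> of type class \<open>power\<close> would be taken entrywise on vectors.\<close>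

primrec matpow :: "'n::finite cmat \<Rightarrow> nat \<Rightarrow> 'n cmat" where
  "matpow A 0 = mat 1"
| "matpow A (Suc k) = A ** matpow A k"

definition comm :: "'n::finite cmat \<Rightarrow> 'n cmat \<Rightarrow> 'n cmat" where
  "comm A B = A ** B - B ** A"

definition su :: "'n::finite cmat set" where
  "su = {A. trace A = 0 \<and> map_matrix cnj (transpose A) = - A}"

text \<open>On \<open>su\<close> the number \<open>trace (A ** B)\<close> is real.\<close>

definition su_inner :: "'n::finite cmat \<Rightarrow> 'n cmat \<Rightarrow> real" where
  "su_inner A B = - Re (trace (A ** B))"

section \<open>The basis \<open>L\<^sub>k\<close>\<close>

definition omega :: "nat \<Rightarrow> complex" where
  "omega N = exp (- 4 * pi * \<i> / N)"

definition clock :: "'n::{finite,linorder} cmat" where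
  "clock = (\<chi> i j. if i = j then omega CARD('n) ^ (pos i - 1) else 0)"

definition shift :: "'n::{finite,linorder} cmat" where
  "shift = (\<chi> i j. if pos j = pos i + 1 \<or> (pos i = CARD('n) \<and> pos j = 1) then 1 else 0)"

text \<open>The representatives of the nonzero elements of \<open>(\<int>/N\<int>)\<^sup>2\<close>, for odd \<open>N\<close>.\<close>

definition modes :: "nat \<Rightarrow> (int \<times> int) set" where
  "modes N = (let m = (int N - 1) div 2 in {-m..m} \<times> {-m..m} - {(0, 0)})"

definition wavenumber :: "int \<times> int \<Rightarrow> real" where
  "wavenumber k = sqrt ((of_int (fst k))\<^sup>2 + (of_int (snd k))\<^sup>2)"

text \<open>For odd \<open>N\<close> the inverse of 2 modulo \<open>N\<close> is \<open>(N + 1) div 2\<close>.  Since \<open>clock\<close> and \<open>shift\<close> have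
  \<open>N\<close>-th power \<open>mat 1\<close>, their exponents are reduced modulo \<open>N\<close> to natural numbers.\<close>

definition Jmat :: "int \<times> int \<Rightarrow> 'n::{finite,linorder} cmat" where
  "Jmat k = (omega CARD('n) powi ((int CARD('n) + 1) div 2 * (fst k * snd k))) *\<^sub>C
     (matpow clock (nat (fst k mod int CARD('n))) ** matpow shift (nat (snd k mod int CARD('n))))"

definition Lmat :: "int \<times> int \<Rightarrow> 'n::{finite,linorder} cmat" where
  "Lmat k = (of_nat CARD('n) / (4 * pi * \<i>)) *\<^sub>C Jmat k"

definition coef :: "'n::{finite,linorder} cmat \<Rightarrow> int \<times> int \<Rightarrow> complex" where
  "coef \<Omega> = (THE c. (\<forall>k. k \<notin> modes CARD('n) \<longrightarrow> c k = 0) \<and>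
                     \<Omega> = (\<Sum>k\<in>modes CARD('n). c k *\<^sub>C Lmat k))"

definition Aop :: "'n::{finite,linorder} cmat \<Rightarrow> 'n cmat" where
  "Aop \<Omega> = (\<Sum>k\<in>modes CARD('n). (of_real ((wavenumber k)\<^sup>2) * coef \<Omega> k) *\<^sub>C Lmat k)"

definition stream :: "'n::{finite,linorder} cmat \<Rightarrow> 'n cmat" where
  "stream \<Omega> = - inv_into su Aop \<Omega>"

section \<open>Truncated energy, enstrophy and their fluxes\<close>

definition energy :: "real \<Rightarrow> 'n::{finite,linorder} cmat \<Rightarrow> real" where
  "energy K \<Omega> = (1/2) * (\<Sum>k\<in>{k \<in> modes CARD('n). wavenumber k \<le> K}.
                            (cmod (coef \<Omega> k))\<^sup>2 / (wavenumber k)\<^sup>2)"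

definition enstrophy :: "real \<Rightarrow> 'n::{finite,linorder} cmat \<Rightarrow> real" where
  "enstrophy K \<Omega> = (1/2) * (\<Sum>k\<in>{k \<in> modes CARD('n). wavenumber k \<le> K}. (cmod (coef \<Omega> k))\<^sup>2)"

text \<open>Both functions are meaningful on the vector space \<open>su\<close> only, so they are differentiated
  within \<open>su\<close>.  As a linear map on all matrices such a derivative is not unique, but its values
  on \<open>su\<close> are, and it is evaluated at \<open>comm (stream \<Omega>) \<Omega> \<in> su\<close>.\<close>

definition energy_flux :: "real \<Rightarrow> 'n::{finite,linorder} cmat \<Rightarrow> real" where
  "energy_flux K \<Omega> = - frechet_derivative (energy K) (at \<Omega> within su) (comm (stream \<Omega>) \<Omega>)"

definition enstrophy_flux :: "real \<Rightarrow> 'n::{finite,linorder} cmat \<Rightarrow> real" where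
  "enstrophy_flux K \<Omega> = - frechet_derivative (enstrophy K) (at \<Omega> within su) (comm (stream \<Omega>) \<Omega>)"

section \<open>Coadjoint orbits\<close>

text \<open>Tuples indexed by \<open>{2..N}\<close> are functions on \<open>nat\<close> that vanish elsewhere; the product topology
  on \<open>nat \<Rightarrow> complex\<close> induces the Euclidean topology on \<open>moment_space N\<close>, a real vector space of
  dimension \<open>N - 1\<close>.\<close>

definition moment_space :: "nat \<Rightarrow> (nat \<Rightarrow> complex) set" where
  "moment_space N = {z. (\<forall>k\<in>{2..N}. \<exists>r::real. z k = \<i> ^ k * of_real r) \<and> (\<forall>k. k \<notin> {2..N} \<longrightarrow> z k = 0)}"

definition moments :: "'n::finite cmat \<Rightarrow> nat \<Rightarrow> complex" where
  "moments \<Omega> = (\<lambda>k. if k \<in> {2..CARD('n)} then trace (matpow \<Omega> k) else 0)"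

definition orbit :: "(nat \<Rightarrow> complex) \<Rightarrow> 'n::finite cmat set" where
  "orbit z = {\<Omega> \<in> su. moments \<Omega> = z}"

definition eigenvalues :: "'n::finite cmat \<Rightarrow> complex set" where
  "eigenvalues \<Omega> = {c. \<exists>v. v \<noteq> 0 \<and> \<Omega> *v v = c *s v}"

definition regular_moments :: "'n::finite itself \<Rightarrow> (nat \<Rightarrow> complex) set" where
  "regular_moments _ = {z \<in> moments ` (su :: 'n cmat set).
     \<forall>\<Omega> \<in> (orbit z :: 'n cmat set). card (eigenvalues \<Omega>) = CARD('n)}"

section \<open>The KKS form and its Liouville measure\<close>

text \<open>The form at \<open>\<Omega>\<close>, on tangent vectors \<open>u = [X,\<Omega>]\<close> and \<open>v = [Y,\<Omega>]\<close> of the orbit.\<close>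

definition kks :: "'n::finite cmat \<Rightarrow> 'n cmat \<Rightarrow> 'n cmat \<Rightarrow> real" where
  "kks \<Omega> u v = (THE r. \<exists>X\<in>su. \<exists>Y\<in>su. u = comm X \<Omega> \<and> v = comm Y \<Omega> \<and> r = su_inner \<Omega> (comm X Y))"

text \<open>A regular orbit has dimension \<open>N\<^sup>2 - N\<close>.  The type \<open>'n offdiag\<close> has \<open>N\<^sup>2 - N\<close> elements when
  \<open>N \<ge> 2\<close> and serves as index type for local coordinates; the second disjunct only makes the
  type nonempty for \<open>N = 1\<close>.\<close>

typedef ('n::finite) offdiag = "{p :: 'n \<times> 'n. fst p \<noteq> snd p \<or> (\<forall>x y :: 'n. x = y)}"
  by auto

instance offdiag :: (finite) finite
proof
  have "(UNIV :: 'a offdiag set) = Abs_offdiag ` {p :: 'a \<times> 'a. fst p \<noteq> snd p \<or> (\<forall>x y :: 'a. x = y)}"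
    by (rule type_definition.Abs_image[OF type_definition_offdiag, symmetric])
  then show "finite (UNIV :: 'a offdiag set)"
    by (rule ssubst) (rule finite_imageI, rule finite)
qed

lemma card_offdiag:
  assumes "CARD('n::finite) \<ge> 2"
  shows "CARD('n offdiag) = CARD('n)\<^sup>2 - CARD('n)"
proof -
  have "\<not> (\<forall>x y :: 'n. x = y)"
  proof
    assume "\<forall>x y :: 'n. x = y"
    then have "CARD('n) \<le> Suc 0"
      by (subst card_le_Suc0_iff_eq) auto
    with assms show False by simp
  qed
  then have *: "{p :: 'n \<times> 'n. fst p \<noteq> snd p \<or> (\<forall>x y :: 'n. x = y)} = UNIV - range (\<lambda>i. (i, i))"
    by (simp only: simp_thms) (auto simp: image_iff)
  have "CARD('n offdiag) = card (UNIV - range (\<lambda>i::'n. (i, i)))"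
    using type_definition.card[OF type_definition_offdiag[where 'n='n]] * by simp
  also have "\<dots> = CARD('n \<times> 'n) - card (range (\<lambda>i::'n. (i, i)))"
    by (rule card_Diff_subset) auto
  also have "card (range (\<lambda>i::'n. (i, i))) = CARD('n)"
    by (rule card_image) (auto simp: inj_on_def)
  finally show ?thesis
    by (simp add: power2_eq_square)
qed

definition orbit_chart ::
  "(nat \<Rightarrow> complex) \<Rightarrow> (real^'n::finite offdiag) set \<Rightarrow> (real^'n offdiag \<Rightarrow> 'n cmat)
    \<Rightarrow> (real^'n offdiag \<Rightarrow> real^'n offdiag \<Rightarrow> 'n cmat) \<Rightarrow> bool" where
  "orbit_chart z U \<phi> \<phi>' \<longleftrightarrow> open U \<and> inj_on \<phi> U \<and> \<phi> ` U \<subseteq> orbit z \<and>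
     (\<forall>x\<in>U. (\<phi> has_derivative \<phi>' x) (at x) \<and> inj (\<phi>' x)) \<and>
     (\<forall>v. continuous_on U (\<lambda>x. \<phi>' x v))"

text \<open>In coordinates \<open>x\<^sub>1, \<dots>, x\<^sub>2\<^sub>d\<close> with Gram matrix \<open>W\<close> of the symplectic form, the Liouville
  volume form is \<open>\<omega>\<^sup>d / d! = Pf W dx\<^sub>1 \<and> \<dots> \<and> dx\<^sub>2\<^sub>d\<close>, and \<open>\<bar>Pf W\<bar> = sqrt (det W)\<close>.\<close>

definition kks_density :: "(real^'n::finite offdiag \<Rightarrow> 'n cmat) \<Rightarrow>
    (real^'n offdiag \<Rightarrow> real^'n offdiag \<Rightarrow> 'n cmat) \<Rightarrow> real^'n offdiag \<Rightarrow> real" where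
  "kks_density \<phi> \<phi>' x =
     sqrt (det (\<chi> a b :: 'n offdiag. kks (\<phi> x) (\<phi>' x (axis a 1)) (\<phi>' x (axis b 1))))"

text \<open>Every chart \<open>\<phi>\<close> of \<open>orbit z\<close> has open image by invariance of domain, and countably many
  images cover the orbit, so these local formulas determine the measure.\<close>

definition kks_liouville :: "(nat \<Rightarrow> complex) \<Rightarrow> 'n::finite cmat measure \<Rightarrow> bool" where
  "kks_liouville z M \<longleftrightarrow> sets M = sets (restrict_space borel (orbit z)) \<and>
     (\<forall>U \<phi> \<phi>'. orbit_chart z U \<phi> \<phi>' \<longrightarrow>
        (\<forall>B\<in>sets M. B \<subseteq> \<phi> ` U \<longrightarrow>
           emeasure M B = (\<integral>\<^sup>+x\<in>U \<inter> \<phi> -` B. ennreal (kks_density \<phi> \<phi>' x) \<partial>lborel)))"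

definition kks_normalized :: "(nat \<Rightarrow> complex) \<Rightarrow> 'n::finite cmat measure \<Rightarrow> bool" where
  "kks_normalized z m \<longleftrightarrow> prob_space m \<and>
     (\<exists>M. kks_liouville z M \<and> m = scale_measure (1 / emeasure M (space M)) M)"

text \<open>The leafwise measure lives on \<open>orbit z\<close>, so these are integrals over the orbit.\<close>

definition avg_energy_flux :: "real \<Rightarrow> 'n::{finite,linorder} cmat measure \<Rightarrow> real" where
  "avg_energy_flux K m = (\<integral>\<Omega>. energy_flux K \<Omega> \<partial>m)"

definition avg_enstrophy_flux :: "real \<Rightarrow> 'n::{finite,linorder} cmat measure \<Rightarrow> real" where
  "avg_enstrophy_flux K m = (\<integral>\<Omega>. enstrophy_flux K \<Omega> \<partial>m)"

end

theory Submission
  imports Defs "HOL-Number_Theory.Cong"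
begin

text \<open>Transposition \<open>\<Omega> \<mapsto> \<Omega>\<^sup>T\<close> is an involution of every orbit: it preserves the traces of powers.
  As an anti-automorphism, \<open>[X,Y]\<^sup>T = - [X\<^sup>T,Y\<^sup>T]\<close>, it reverses the sign of the KKS form and therefore
  preserves the Liouville volume.  It maps \<open>Lmat (a, b)\<close> to \<open>Lmat (a, - b)\<close>, so it preserves the
  wavenumber, commutes with \<open>A\<close> and preserves the truncated energy and enstrophy.  In the flux only the
  commutator \<open>[\<Psi>,\<Omega>]\<close> changes sign; the fluxes are odd and their averages vanish.

  Invariance of the measure is checked in charts, so charts must cover the orbit.  Near a diagonal
  element with distinct eigenvalues they come from the inverse function theorem, applied to the
  off-diagonal entries together with the moments; the derivative is injective by Vandermonde.
  Unitary conjugation moves them to the other points.\<close>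

section \<open>Transposition and the Liouville measure\<close>

text \<open>The condition \<open>kks_liouville\<close> constrains a measure only on subsets of chart
  images, so a part of the orbit that no chart reaches could carry arbitrary mass. Charts therefore
  have to be built, not merely used. The inverse function theorem works on a whole Euclidean space,
  while \<open>su\<close> is a thin subset of the matrices. The straightening map is therefore
  defined on all complex matrices: it keeps the off-diagonal entries and the real parts of the
  diagonal, and trades the N imaginary parts of the diagonal for the traces of the powers 1, ..., N.
  Lying on the orbit of a diagonal element then becomes an affine condition on the image.
  Transposition acts on the basis without a scalar factor because of the phase k1 k2 / 2: it fixes
  the clock, inverts the shift and reverses their order, and the phase absorbs exactly the root of
  unity that reordering costs. A derivative within \<open>su\<close> is a choice among many linear
  maps, so the oddness of the fluxes rests on the fact that all choices agree on directions in
  \<open>su\<close>.\<close>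

lemma transpose_diff: "transpose (A - B) = transpose A - transpose (B :: 'a::ab_group_add^'n^'m)"
  by (simp add: transpose_def vec_eq_iff)

lemma transpose_minus: "transpose (- A) = - transpose (A :: 'a::ab_group_add^'n^'m)"
  by (simp add: transpose_def vec_eq_iff)

lemma trace_transpose [simp]: "trace (transpose A) = trace A"
  by (simp add: trace_def transpose_def)

lemma linear_transpose: "linear (transpose :: 'a::real_vector^'n^'m \<Rightarrow> _)"
  by (rule linearI) (simp_all add: transpose_def vec_eq_iff)

lemma bounded_linear_transpose: "bounded_linear (transpose :: 'a::euclidean_space^'n^'m \<Rightarrow> _)"
  by (rule linear_conv_bounded_linear[THEN iffD1, OF linear_transpose])

lemma matpow_commute: "A ** matpow A k = matpow A k ** A"
proof (induction k)
  case (Suc k)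
  have "A ** matpow A (Suc k) = A ** (matpow A k ** A)"
    using Suc by simp
  then show ?case
    by (simp add: matrix_mul_assoc)
qed simp

lemma transpose_matpow: "transpose (matpow A k) = matpow (transpose A) k"
  by (induction k) (simp_all add: matrix_transpose_mul matpow_commute[symmetric])

lemma transpose_comm: "transpose (comm A B) = - comm (transpose A) (transpose B)"
  by (simp add: comm_def matrix_transpose_mul transpose_diff)

lemma comm_uminus_left: "comm (- A) B = - comm A B"
  by (simp add: comm_def vec_eq_iff matrix_matrix_mult_def sum_negf)

lemma comm_uminus_right: "comm A (- B) = - comm A B"
  by (simp add: comm_def vec_eq_iff matrix_matrix_mult_def sum_negf)

lemma su_iff: "A \<in> su \<longleftrightarrow> trace A = 0 \<and> (\<forall>i j. cnj (A $ j $ i) = - A $ i $ j)"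
  by (simp add: su_def transpose_def vec_eq_iff)

lemma transpose_in_su: "A \<in> su \<Longrightarrow> transpose A \<in> su"
  unfolding su_iff by (simp add: transpose_def trace_def)

lemma uminus_in_su: "A \<in> su \<Longrightarrow> - A \<in> su"
  unfolding su_iff by (simp add: trace_def sum_negf)

lemma moments_transpose: "moments (transpose A) = moments A"
  by (auto simp: moments_def transpose_matpow[symmetric])

lemma transpose_in_orbit: "A \<in> orbit z \<Longrightarrow> transpose A \<in> orbit z"
  by (simp add: orbit_def transpose_in_su moments_transpose)

lemma su_inner_transpose: "su_inner (transpose A) (transpose B) = su_inner A B"
proof -
  have "trace (transpose A ** transpose B) = trace (transpose (B ** A))"
    by (simp add: matrix_transpose_mul)
  then show ?thesis
    unfolding su_inner_def trace_transpose by (subst trace_mul_sym[of A B]) (rule arg_cong)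
qed

text \<open>If \<open>X\<close> and \<open>Y\<close> generate the tangent vectors at
  \<open>\<Omega>\<close>, then \<open>- transpose X\<close> and \<open>- transpose Y\<close>
  generate the transposed vectors, and their commutator is minus the transpose of
  \<open>comm X Y\<close>. The sign is recorded as a swap of arguments: the two definite
  descriptions then range over the same candidates, and neither uniqueness of the value nor
  antisymmetry has to be shown.\<close>

lemma kks_transpose: "kks (transpose \<Omega>) (transpose u) (transpose v) = kks \<Omega> v u"
proof -
  \<comment> \<open>One implication for arbitrary \<open>W\<close>, \<open>u\<close>,
    \<open>v\<close> is enough, since the other is the same statement at the transposed
    arguments.\<close>
  have *: "\<exists>X\<in>su. \<exists>Y\<in>su. u = comm X (transpose W) \<and> v = comm Y (transpose W) \<and> r = su_inner (transpose W) (comm X Y)"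
    if "X \<in> su" "Y \<in> su" "transpose v = comm X W" "transpose u = comm Y W" "r = su_inner W (comm X Y)"
    for W X Y and u v :: "'a cmat" and r
  proof (intro bexI conjI)
    show "u = comm (- transpose Y) (transpose W)"
      using that(4) by (metis transpose_comm comm_uminus_left transpose_transpose)
    show "v = comm (- transpose X) (transpose W)"
      using that(3) by (metis transpose_comm comm_uminus_left transpose_transpose)
    have "comm (- transpose Y) (- transpose X) = transpose (comm X Y)"
      by (simp add: transpose_comm comm_uminus_left comm_uminus_right) (simp add: comm_def)
    then show "r = su_inner (transpose W) (comm (- transpose Y) (- transpose X))"
      by (simp add: that(5) su_inner_transpose)
  qed (use that in \<open>simp_all add: uminus_in_su transpose_in_su\<close>)
  have "(\<exists>X\<in>su. \<exists>Y\<in>su. transpose u = comm X (transpose \<Omega>) \<and> transpose v = comm Y (transpose \<Omega>)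
            \<and> r = su_inner (transpose \<Omega>) (comm X Y)) \<longleftrightarrow>
        (\<exists>X\<in>su. \<exists>Y\<in>su. v = comm X \<Omega> \<and> u = comm Y \<Omega> \<and> r = su_inner \<Omega> (comm X Y))" for r
    using *[where u = v and v = u and W = "transpose \<Omega>"] *[where u = "transpose u" and v = "transpose v" and W = \<Omega>]
    unfolding transpose_transpose by blast
  then show ?thesis
    unfolding kks_def by simp
qed

lemma orbit_chart_transpose:
  assumes "orbit_chart z U \<phi> \<phi>'"
  shows "orbit_chart z U (\<lambda>x. transpose (\<phi> x)) (\<lambda>x v. transpose (\<phi>' x v))"
  unfolding orbit_chart_def
proof (intro conjI ballI allI)
  show "open U" "inj_on (\<lambda>x. transpose (\<phi> x)) U"
    using assms by (auto simp: orbit_chart_def inj_on_def)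
  show "(\<lambda>x. transpose (\<phi> x)) ` U \<subseteq> orbit z"
    using assms transpose_in_orbit by (auto simp: orbit_chart_def)
  show "((\<lambda>x. transpose (\<phi> x)) has_derivative (\<lambda>v. transpose (\<phi>' x v))) (at x)" if "x \<in> U" for x
    using assms that by (auto simp: orbit_chart_def intro: bounded_linear.has_derivative[OF bounded_linear_transpose])
  show "inj (\<lambda>v. transpose (\<phi>' x v))" if "x \<in> U" for x
    using assms that by (auto simp: orbit_chart_def inj_def)
  show "continuous_on U (\<lambda>x. transpose (\<phi>' x v))" for v
    using assms by (auto simp: orbit_chart_def intro: bounded_linear.continuous_on[OF bounded_linear_transpose])
qed

text \<open>Swapping the arguments of the form transposes the Gram matrix, which leaves its
  determinant alone.\<close>

lemma kks_density_transpose: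
  "kks_density (\<lambda>x. transpose (\<phi> x)) (\<lambda>x v. transpose (\<phi>' x v)) x = kks_density \<phi> \<phi>' x"
proof -
  let ?W = "\<chi> a b. kks (\<phi> x) (\<phi>' x (axis a 1)) (\<phi>' x (axis b 1))"
  have "(\<chi> a b. kks (transpose (\<phi> x)) (transpose (\<phi>' x (axis a 1))) (transpose (\<phi>' x (axis b 1)))) = transpose ?W"
    unfolding kks_transpose by (simp add: transpose_def)
  then show ?thesis
    unfolding kks_density_def by (simp add: det_transpose)
qed

lemma transpose_measurable:
  fixes M :: "'n::finite cmat measure"
  assumes "sets M = sets (restrict_space borel (orbit z))"
  shows "transpose \<in> measurable M M"
proof -
  have "continuous_on UNIV (transpose :: 'n cmat \<Rightarrow> _)"
    by (rule bounded_linear.continuous_on[OF bounded_linear_transpose]) (rule continuous_on_id)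
  then have "(transpose :: 'n cmat \<Rightarrow> _) \<in> borel_measurable borel"
    by (rule borel_measurable_continuous_onI)
  then have "(transpose :: 'n cmat \<Rightarrow> _) \<in> measurable (restrict_space borel (orbit z)) (restrict_space borel (orbit z))"
    by (intro measurable_restrict_space3) (auto intro: transpose_in_orbit)
  then show ?thesis
    using measurable_cong_sets[OF assms assms] by simp
qed

lemma kks_liouville_chart:
  assumes "kks_liouville z M" "orbit_chart z U \<phi> \<phi>'" "B \<in> sets M" "B \<subseteq> \<phi> ` U"
  shows "emeasure M B = (\<integral>\<^sup>+x\<in>U \<inter> \<phi> -` B. ennreal (kks_density \<phi> \<phi>' x) \<partial>lborel)"
  using assms(1)[unfolded kks_liouville_def, THEN conjunct2, rule_format, OF assms(2-4)] .

text \<open>The transposed chart describes the transposed set over the same region of coordinates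
  and with the same density, so both measures are one and the same integral.\<close>

lemma kks_liouville_transpose_chart:
  assumes "kks_liouville z M" "orbit_chart z U \<phi> \<phi>'" "B \<in> sets M" "B \<subseteq> \<phi> ` U"
  shows "emeasure M (transpose -` B \<inter> space M) = emeasure M B"
proof -
  let ?\<psi> = "\<lambda>x. transpose (\<phi> x)"
  let ?\<psi>' = "\<lambda>x v. transpose (\<phi>' x v)"
  have sets: "sets M = sets (restrict_space borel (orbit z))"
    using assms(1) by (simp add: kks_liouville_def)
  have space: "space M = orbit z"
    using sets_eq_imp_space_eq[OF sets] by (simp add: space_restrict_space)
  let ?B = "transpose -` B \<inter> space M"
  have B: "?B \<in> sets M"
    using measurable_sets[OF transpose_measurable[OF sets] assms(3)] .
  have chart: "orbit_chart z U ?\<psi> ?\<psi>'"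
    by (rule orbit_chart_transpose[OF assms(2)])
  have sub: "?B \<subseteq> ?\<psi> ` U"
  proof
    fix A assume "A \<in> ?B"
    then obtain x where "x \<in> U" "transpose A = \<phi> x" using assms(4) by auto
    then show "A \<in> ?\<psi> ` U" by (metis imageI transpose_transpose)
  qed
  have im: "\<phi> x \<in> orbit z" if "x \<in> U" for x
    using assms(2) that by (auto simp: orbit_chart_def)
  have eq: "U \<inter> ?\<psi> -` ?B = U \<inter> \<phi> -` B"
    using im transpose_in_orbit unfolding space by auto
  have "emeasure M ?B = (\<integral>\<^sup>+x\<in>U \<inter> ?\<psi> -` ?B. ennreal (kks_density ?\<psi> ?\<psi>' x) \<partial>lborel)"
    by (rule kks_liouville_chart[OF assms(1) chart B sub])
  also have "\<dots> = (\<integral>\<^sup>+x\<in>U \<inter> \<phi> -` B. ennreal (kks_density \<phi> \<phi>' x) \<partial>lborel)"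
    unfolding eq kks_density_transpose ..
  also have "\<dots> = emeasure M B"
    by (rule kks_liouville_chart[OF assms, symmetric])
  finally show ?thesis .
qed

text \<open>Charts pin down the measure because countably many of them cover the orbit.\<close>

lemma distr_transpose_kks_liouville:
  fixes M :: "'n::finite cmat measure"
  assumes M: "kks_liouville z M"
    and charts: "\<And>\<Omega> :: 'n cmat. \<Omega> \<in> orbit z \<Longrightarrow>
      \<exists>U \<phi> \<phi>' S. orbit_chart z U \<phi> \<phi>' \<and> open S \<and> \<Omega> \<in> S \<and> \<phi> ` U = orbit z \<inter> S"
  shows "distr M M transpose = M"
proof -
  have sets: "sets M = sets (restrict_space borel (orbit z))"
    using M by (simp add: kks_liouville_def)
  have space: "space M = orbit z"
    using sets_eq_imp_space_eq[OF sets] by (simp add: space_restrict_space)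
  define F where "F = {S :: 'n cmat set. open S \<and> (\<exists>U \<phi> \<phi>'. orbit_chart z U \<phi> \<phi>' \<and> \<phi> ` U = orbit z \<inter> S)}"
  have F_open: "\<And>S. S \<in> F \<Longrightarrow> open S" by (auto simp: F_def)
  obtain F' where F': "F' \<subseteq> F" "countable F'" "\<Union>F' = \<Union>F"
    by (rule Lindelof[of F, OF F_open])
  have cover: "orbit z \<subseteq> \<Union>F'"
  proof
    fix \<Omega> :: "'n cmat" assume "\<Omega> \<in> orbit z"
    then obtain U \<phi> \<phi>' S where "orbit_chart z U \<phi> \<phi>'" "open S" "\<Omega> \<in> S" "\<phi> ` U = orbit z \<inter> S"
      using charts[of \<Omega>] by blast
    then have "S \<in> F" unfolding F_def by blast
    then show "\<Omega> \<in> \<Union>F'" unfolding F'(3) using \<open>\<Omega> \<in> S\<close> by blast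
  qed
  show ?thesis
  \<comment> \<open>An empty cover means an empty orbit; it is split off because enumerating
    \<open>F'\<close> by \<open>from_nat_into\<close> needs a nonempty set.\<close>
  proof (cases "F' = {}")
    case True
    then have "space M = {}"
      unfolding space using cover by blast
    then have "A = {}" if "A \<in> sets M" for A
      using sets.sets_into_space[OF that] by blast
    then show ?thesis
      by (intro measure_eqI) (simp, metis emeasure_empty sets_distr)
  next
    case False
    define S where "S = from_nat_into F'"
    have S: "range S = F'"
      unfolding S_def using False F'(2) by (rule range_from_nat_into)
    define R where "R n = orbit z \<inter> S n" for n
    have R_sets: "R n \<in> sets M" for n
    proof -
      have "open (S n)" using S F'(1) F_open by blast
      then show ?thesis
        unfolding sets R_def sets_restrict_space by auto
    qed
    have T: "transpose \<in> measurable M M"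
      by (rule transpose_measurable[OF sets])
    \<comment> \<open>The chart formula speaks only about subsets of one chart image. Disjoint
      pieces, each inside a single \<open>R n\<close>, let countable additivity assemble an
      arbitrary measurable set.\<close>
    define D where "D = disjointed R"
    have D_sets: "range D \<subseteq> sets M"
      unfolding D_def using R_sets by (intro sets.range_disjointed_sets) auto
    have D_un: "(\<Union>n. D n) = orbit z"
      unfolding D_def UN_disjointed_eq using cover S by (auto simp: R_def)
    have D_disj: "disjoint_family D"
      unfolding D_def by (rule disjoint_family_disjointed)
    show ?thesis
    proof (rule measure_eqI)
      fix A assume "A \<in> sets (distr M M transpose)"
      then have A: "A \<in> sets M" by simp
      have chart_piece: "emeasure (distr M M transpose) (A \<inter> D n) = emeasure M (A \<inter> D n)" for n
      proof -
        have "S n \<in> F" using S F'(1) by auto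
        then obtain U \<phi> \<phi>' where c: "orbit_chart z U \<phi> \<phi>'" "\<phi> ` U = R n"
          unfolding F_def R_def by auto
        have "A \<inter> D n \<in> sets M" using A D_sets by auto
        moreover have "A \<inter> D n \<subseteq> \<phi> ` U"
          unfolding c(2) D_def using disjointed_subset[of R n] by auto
        ultimately have "emeasure M (transpose -` (A \<inter> D n) \<inter> space M) = emeasure M (A \<inter> D n)"
          by (rule kks_liouville_transpose_chart[OF M c(1)])
        then show ?thesis using T \<open>A \<inter> D n \<in> sets M\<close> by (simp add: emeasure_distr)
      qed
      have split: "emeasure N A = (\<Sum>n. emeasure N (A \<inter> D n))" if "sets N = sets M" for N
      proof -
        have "(\<Sum>n. emeasure N (A \<inter> D n)) = emeasure N (\<Union>n. A \<inter> D n)"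
          using A D_sets D_disj that
          by (intro suminf_emeasure) (auto simp: disjoint_family_on_def)
        also have "(\<Union>n. A \<inter> D n) = A"
          using D_un sets.sets_into_space[OF A] space by auto
        finally show ?thesis ..
      qed
      show "emeasure (distr M M transpose) A = emeasure M A"
        using split[of "distr M M transpose"] split[of M] chart_piece by simp
    qed simp
  qed
qed

lemma distr_scale_measure:
  assumes "f \<in> measurable M N"
  shows "distr (scale_measure r M) N f = scale_measure r (distr M N f)"
proof (rule measure_eqI)
  have "f \<in> measurable (scale_measure r M) N"
    using assms by (simp cong: measurable_cong_sets)
  then show "emeasure (distr (scale_measure r M) N f) A = emeasure (scale_measure r (distr M N f)) A"
    if "A \<in> sets (distr (scale_measure r M) N f)" for A
    using that assms by (simp add: emeasure_distr space_scale_measure)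
qed simp

section \<open>Regular elements\<close>

text \<open>Vandermonde without determinants. The polynomial \<open>p\<close> vanishes at every node
  except \<open>d i\<close> and has degree below \<open>card I\<close>, so the sum of
  \<open>y j * poly p (d j)\<close> is a combination of the vanishing power sums and at the same
  time reduces to the term of \<open>i\<close>.\<close>

lemma power_sums_eq_0_imp_eq_0:
  fixes d :: "'i \<Rightarrow> 'a::field"
  assumes "finite I" "inj_on d I" and sums: "\<And>k. k < card I \<Longrightarrow> (\<Sum>i\<in>I. y i * d i ^ k) = 0"
    and "i \<in> I"
  shows "y i = 0"
proof -
  define p where "p = (\<Prod>j\<in>I - {i}. [:- d j, 1:])"
  have deg: "degree p < card I"
    using assms(1,4) card_Diff1_less[of I i] unfolding p_def by (subst degree_prod_eq_sum_degree) auto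
  have "(\<Sum>j\<in>I. y j * poly p (d j)) = (\<Sum>j\<in>I. \<Sum>k\<le>degree p. coeff p k * (y j * d j ^ k))"
    by (simp add: poly_altdef sum_distrib_left algebra_simps)
  also have "\<dots> = (\<Sum>k\<le>degree p. coeff p k * (\<Sum>j\<in>I. y j * d j ^ k))"
    by (subst sum.swap) (simp add: sum_distrib_left)
  also have "\<dots> = 0"
    using sums deg by (intro sum.neutral) auto
  finally have "(\<Sum>j\<in>I. y j * poly p (d j)) = 0" .
  moreover have "(\<Sum>j\<in>I. y j * poly p (d j)) = (\<Sum>j\<in>{i}. y j * poly p (d j))"
    using assms(1,4) by (intro sum.mono_neutral_right) (auto simp: p_def poly_prod)
  moreover have "poly p (d i) \<noteq> 0"
    using assms(1,2,4) by (auto simp: p_def poly_prod inj_on_def)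
  ultimately show ?thesis by simp
qed

text \<open>Supplies the continuity of derivatives that \<open>orbit_chart\<close> demands, since
  the derivative of a local inverse is known only as a pointwise inverse. If \<open>F y0\<close> is
  bounded below by \<open>B\<close> and \<open>F y\<close> is within \<open>B / 2\<close> of it,
  then \<open>F y\<close> is bounded below by \<open>B / 2\<close>. This controls the error
  \<open>x\<close>, because \<open>F y\<close> maps it to \<open>F y0 w0 - F y w0\<close>.\<close>

lemma continuous_on_inv_blinfun_apply:
  fixes F :: "'a::topological_space \<Rightarrow> 'b::euclidean_space \<Rightarrow>\<^sub>L 'b"
  assumes cont: "continuous_on S F" and bij: "\<And>y. y \<in> S \<Longrightarrow> bij (blinfun_apply (F y))"
  shows "continuous_on S (\<lambda>y. inv (blinfun_apply (F y)) v)"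
  unfolding continuous_on_def
proof
  fix y0 assume "y0 \<in> S"
  define w0 where "w0 = inv (blinfun_apply (F y0)) v"
  have w: "blinfun_apply (F y) (inv (blinfun_apply (F y)) v) = v" if "y \<in> S" for y
    using bij[OF that] by (simp add: bij_is_surj surj_f_inv_f)
  obtain B where B: "B > 0" "\<And>x. B * norm x \<le> norm (blinfun_apply (F y0) x)"
    using linear_inj_bounded_below_pos[of "blinfun_apply (F y0)"] bij[OF \<open>y0 \<in> S\<close>]
    by (metis bij_is_inj blinfun.bounded_linear_right linear_conv_bounded_linear)
  have lim: "(F \<longlongrightarrow> F y0) (at y0 within S)"
    using cont \<open>y0 \<in> S\<close> by (simp add: continuous_on_def)
  have "\<forall>\<^sub>F y in at y0 within S. dist (F y) (F y0) < B / 2"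
    using lim B(1) by (intro tendstoD) auto
  moreover have "\<forall>\<^sub>F y in at y0 within S. y \<in> S"
    by (simp add: eventually_at_filter)
  ultimately have ev: "\<forall>\<^sub>F y in at y0 within S.
      norm (inv (blinfun_apply (F y)) v - w0) \<le> (2 / B) * norm (blinfun_apply (F y0) w0 - blinfun_apply (F y) w0)"
  proof eventually_elim
    case (elim y)
    define x where "x = inv (blinfun_apply (F y)) v - w0"
    have "norm (blinfun_apply (F y - F y0) x) \<le> B / 2 * norm x"
      using norm_blinfun[of "F y - F y0" x] elim(1) mult_right_mono[of "norm (F y - F y0)" "B/2" "norm x"]
      by (simp add: dist_norm)
    moreover have "blinfun_apply (F y) x = blinfun_apply (F y0) w0 - blinfun_apply (F y) w0"
      using w[OF elim(2)] w[OF \<open>y0 \<in> S\<close>] by (simp add: x_def blinfun.diff_right w0_def)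
    moreover have "norm (blinfun_apply (F y0) x) \<le> norm (blinfun_apply (F y) x) + norm (blinfun_apply (F y - F y0) x)"
      using norm_triangle_ineq4[of "blinfun_apply (F y) x" "blinfun_apply (F y - F y0) x"]
      by (simp add: blinfun.diff_left)
    ultimately have "B / 2 * norm x \<le> norm (blinfun_apply (F y0) w0 - blinfun_apply (F y) w0)"
      using B(2)[of x] by simp
    then show ?case
      using B(1) by (simp add: x_def field_simps)
  qed
  have "((\<lambda>y. (2 / B) * norm (blinfun_apply (F y0) w0 - blinfun_apply (F y) w0)) \<longlongrightarrow>
      (2 / B) * norm (blinfun_apply (F y0) w0 - blinfun_apply (F y0) w0)) (at y0 within S)"
    by (intro tendsto_intros lim)
  then have "((\<lambda>y. (2 / B) * norm (blinfun_apply (F y0) w0 - blinfun_apply (F y) w0)) \<longlongrightarrow> 0) (at y0 within S)"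
    by simp
  then have "((\<lambda>y. inv (blinfun_apply (F y)) v - w0) \<longlongrightarrow> 0) (at y0 within S)"
    by (rule Lim_null_comparison[OF ev])
  then show "((\<lambda>y. inv (blinfun_apply (F y)) v) \<longlongrightarrow> inv (blinfun_apply (F y0)) v) (at y0 within S)"
    unfolding w0_def by (rule LIM_zero_cancel)
qed

section \<open>Unitary diagonalization of regular elements\<close>

abbreviation hconj :: "'n::finite cmat \<Rightarrow> 'n cmat" where
  "hconj A \<equiv> map_matrix cnj (transpose A)"

definition diagm :: "('n \<Rightarrow> complex) \<Rightarrow> 'n::finite cmat" where
  "diagm d = (\<chi> i j. if i = j then d i else 0)"

lemma hconj_mult: "hconj (A ** B) = hconj B ** hconj A"
  by (simp add: vec_eq_iff transpose_def matrix_matrix_mult_def mult.commute)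

lemma hconj_hconj [simp]: "hconj (hconj A) = A"
  by (simp add: vec_eq_iff transpose_def)

lemma mult_diagm_nth:
  "(V ** diagm d) $ i $ j = V $ i $ j * d j"
  by (simp add: matrix_matrix_mult_def diagm_def if_distrib cong: if_cong)

text \<open>N distinct eigenvalues can be indexed by \<open>'n\<close> itself, with one eigenvector
  each. Skewness makes these eigenvectors orthogonal, so after normalization they are the columns of
  a unitary matrix.\<close>

lemma su_regular_diagonalizable:
  fixes A :: "'n::finite cmat"
  assumes A: "A \<in> su" and card: "card (eigenvalues A) = CARD('n)"
  obtains V d where "hconj V ** V = mat 1" "V ** hconj V = mat 1" "inj d" "A = V ** diagm d ** hconj V"
proof -
  have "finite (eigenvalues A)"
    using card by (metis card.infinite zero_less_card_finite less_irrefl)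
  then obtain d :: "'n \<Rightarrow> complex" where d: "bij_betw d UNIV (eigenvalues A)"
    using finite_same_card_bij[of "UNIV :: 'n set" "eigenvalues A"] card by auto
  have "\<exists>v. v \<noteq> 0 \<and> A *v v = d i *s v" for i
    using d unfolding bij_betw_def eigenvalues_def by blast
  then obtain v where v: "\<And>i. v i \<noteq> 0" "\<And>i. A *v v i = d i *s v i"
    by metis
  have inj: "inj d" using d by (simp add: bij_betw_def)
  define h where "h u w = (\<Sum>k\<in>UNIV. cnj (u $ k) * w $ k)" for u w :: "complex^'n"
  have hA: "h u (A *v w) = - h (A *v u) w" for u w
  proof -
    have A_cnj: "cnj (A $ i $ j) = - A $ j $ i" for i j
      using A by (simp add: su_iff)
    have "h u (A *v w) = (\<Sum>k\<in>UNIV. \<Sum>j\<in>UNIV. cnj (u $ k) * A $ k $ j * w $ j)"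
      by (simp add: h_def matrix_vector_mult_def sum_distrib_left mult.assoc)
    also have "\<dots> = (\<Sum>j\<in>UNIV. \<Sum>k\<in>UNIV. cnj (u $ k) * A $ k $ j * w $ j)"
      by (rule sum.swap)
    also have "\<dots> = - h (A *v u) w"
      by (simp add: h_def matrix_vector_mult_def sum_distrib_left sum_distrib_right sum_negf A_cnj mult_ac)
    finally show ?thesis .
  qed
  \<comment> \<open>This single identity is used twice: for \<open>i = j\<close> it makes the
    eigenvalues imaginary, and for \<open>i \<noteq> j\<close> the factor is then a nonzero
    difference of eigenvalues, which forces orthogonality.\<close>
  have h_ev: "(d j + cnj (d i)) * h (v i) (v j) = 0" for i j
  proof -
    have "h (v i) (A *v v j) = d j * h (v i) (v j)"
      by (simp add: v h_def sum_distrib_left mult_ac)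
    moreover have "h (A *v v i) (v j) = cnj (d i) * h (v i) (v j)"
      by (simp add: v h_def sum_distrib_left mult_ac)
    ultimately show ?thesis
      using hA[of "v i" "v j"] by (metis distrib_right eq_neg_iff_add_eq_0)
  qed
  define c where "c i = (\<Sum>k\<in>UNIV. (cmod (v i $ k))\<^sup>2)" for i
  have h_self: "h (v i) (v i) = of_real (c i)" for i
    by (simp add: h_def c_def complex_norm_square mult.commute del: of_real_power)
  have c_pos: "c i > 0" for i
  proof -
    obtain k where "v i $ k \<noteq> 0"
      using v(1)[of i] by (auto simp: vec_eq_iff)
    then show ?thesis
      unfolding c_def by (intro sum_pos2[of _ k]) auto
  qed
  have cnj_d: "cnj (d i) = - d i" for i
    using h_ev[of i i] c_pos[of i] by (simp add: h_self eq_neg_iff_add_eq_0 add.commute)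
  have h_orth: "h (v i) (v j) = 0" if "i \<noteq> j" for i j
    using h_ev[of j i] inj that by (simp add: cnj_d inj_eq)
  define V where "V = (\<chi> k i. v i $ k / of_real (sqrt (c i)))"
  have "(hconj V ** V) $ i $ j = h (v i) (v j) / of_real (sqrt (c i) * sqrt (c j))" for i j
    by (simp add: V_def matrix_matrix_mult_def transpose_def h_def sum_divide_distrib)
  then have VV: "hconj V ** V = mat 1"
    using c_pos c_pos[THEN less_imp_neq, symmetric] by (auto simp: vec_eq_iff mat_def h_orth h_self less_imp_le abs_of_pos
        simp flip: of_real_mult of_real_divide)
  then have VV': "V ** hconj V = mat 1"
    by (simp add: matrix_left_right_inverse)
  have "(A ** V) $ k $ i = (A *v v i) $ k / of_real (sqrt (c i))" for k i
    by (simp add: V_def matrix_matrix_mult_def matrix_vector_mult_def sum_divide_distrib)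
  then have "A ** V = V ** diagm d"
    unfolding vec_eq_iff mult_diagm_nth by (simp add: v V_def)
  then have "V ** diagm d ** hconj V = A"
    by (metis VV' matrix_mul_assoc matrix_mul_rid)
  with VV VV' inj show thesis
    by (intro that) auto
qed

section \<open>Charts of regular orbits\<close>

lemma bilinear_matrix_mult:
  "bilinear ((**) :: 'n::finite cmat \<Rightarrow> 'n cmat \<Rightarrow> 'n cmat)"
  unfolding bilinear_def
  by (intro conjI allI linearI)
     (simp_all add: vec_eq_iff matrix_matrix_mult_def algebra_simps sum.distrib scaleR_sum_right)

lemmas bounded_bilinear_matrix_mult = bilinear_matrix_mult[unfolded bilinear_conv_bounded_bilinear]

text \<open>The Leibniz rule applied along the recursion of \<open>matpow\<close>. Since
  \<open>A\<close> and \<open>u\<close> need not commute, there is no closed form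
  \<open>k * A^(k-1) * u\<close>.\<close>

primrec dmatpow :: "'n::finite cmat \<Rightarrow> 'n cmat \<Rightarrow> nat \<Rightarrow> 'n cmat" where
  "dmatpow A u 0 = 0"
| "dmatpow A u (Suc k) = A ** dmatpow A u k + u ** matpow A k"

lemma has_derivative_matpow:
  "((\<lambda>A. matpow A k) has_derivative (\<lambda>u. dmatpow A u k)) (at A within S)"
proof (induction k)
  case (Suc k)
  then show ?case
    using bounded_bilinear.FDERIV[OF bounded_bilinear_matrix_mult has_derivative_ident Suc] by simp
qed simp

lemma continuous_on_matpow: "continuous_on S (\<lambda>A. matpow A k)"
  by (rule has_derivative_continuous_on[OF has_derivative_matpow])

lemma continuous_on_dmatpow: "continuous_on S (\<lambda>A. dmatpow A u k)"
proof (induction k)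
  case (Suc k)
  then show ?case
    by (auto intro!: continuous_on_add continuous_on_id continuous_on_const continuous_on_matpow
        bounded_bilinear.continuous_on[OF bounded_bilinear_matrix_mult])
qed simp

lemma matpow_diagm: "matpow (diagm d) k = diagm (\<lambda>i. d i ^ k)"
  by (induction k) (simp_all add: diagm_def mat_def vec_eq_iff matrix_matrix_mult_def if_distrib if_distribR cong: if_cong)

text \<open>At a diagonal base point each of the \<open>k\<close> Leibniz terms has the same
  diagonal entry, because the powers of \<open>d i\<close> to the left and to the right of
  \<open>u\<close> multiply together. The truncated \<open>k - 1\<close> is harmless at
  \<open>k = 0\<close>, where the factor \<open>k\<close> vanishes.\<close>

lemma diag_dmatpow_diagm:
  "dmatpow (diagm d) u k $ i $ i = of_nat k * d i ^ (k - 1) * u $ i $ i"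
proof (induction k)
  case (Suc k)
  have "dmatpow (diagm d) u (Suc k) $ i $ i = d i * dmatpow (diagm d) u k $ i $ i + u $ i $ i * d i ^ k"
    unfolding dmatpow.simps matpow_diagm
    by (simp add: matrix_matrix_mult_def diagm_def if_distrib if_distribR cong: if_cong)
  then show ?case
    unfolding Suc by (cases k) (simp_all add: algebra_simps)
qed simp

lemma hconj_matpow: "hconj (matpow A k) = matpow (hconj A) k"
proof (induction k)
  case 0
  show ?case by (simp add: vec_eq_iff mat_def transpose_def)
next
  case (Suc k)
  then show ?case by (simp add: hconj_mult matpow_commute[symmetric])
qed

lemma matpow_uminus: "matpow (- A) k = (- 1) ^ k *\<^sub>C matpow A k"
  by (induction k)
     (simp_all add: vec_eq_iff matrix_matrix_mult_def cscale_def sum_negf sum_distrib_left mult_ac)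

text \<open>Conjugate transposition multiplies the \<open>k\<close>-th power of a skew-Hermitian
  matrix by (-1)^k, so its trace is a real multiple of i^k. Hence the real part taken in
  \<open>straighten\<close> loses nothing on \<open>su\<close>.\<close>

lemma Im_trace_matpow:
  assumes "hconj A = - A"
  shows "Im ((- \<i>) ^ k * trace (matpow A k)) = 0"
proof -
  let ?t = "trace (matpow A k)"
  have "cnj ?t = trace (hconj (matpow A k))"
    by (simp add: trace_def transpose_def)
  also have "\<dots> = (- 1) ^ k * ?t"
    by (simp add: hconj_matpow assms matpow_uminus) (simp add: trace_def cscale_def sum_distrib_left)
  finally have "cnj ((- \<i>) ^ k * ?t) = \<i> ^ k * (- 1) ^ k * ?t"
    by simp
  also have "\<dots> = (- \<i>) ^ k * ?t"
    by (simp flip: power_mult_distrib)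
  finally show ?thesis
    by (metis cnj.simps(2) equal_neg_zero)
qed

text \<open>Replacing the imaginary parts of the diagonal by the moments straightens the orbits: near a
  regular diagonal element of \<open>su\<close>, an orbit is where the diagonal of \<open>straighten A\<close> is constant.\<close>

definition straighten :: "'n::{finite,linorder} cmat \<Rightarrow> 'n cmat" where
  "straighten A = (\<chi> i j. if i = j
     then Complex (Re (A $ i $ i)) (Re ((- \<i>) ^ pos i * trace (matpow A (pos i)))) else A $ i $ j)"

definition dstraighten :: "'n::{finite,linorder} cmat \<Rightarrow> 'n cmat \<Rightarrow> 'n cmat" where
  "dstraighten A u = (\<chi> i j. if i = j
     then Complex (Re (u $ i $ i)) (Re ((- \<i>) ^ pos i * trace (dmatpow A u (pos i)))) else u $ i $ j)"

text \<open>Isolates all nonlinearity in the matrix powers: \<open>E i\<close> only writes a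
  normalized trace into the diagonal place \<open>i\<close>. Differentiability and continuity of the
  derivative then follow from those of \<open>matpow\<close> and \<open>dmatpow\<close>.\<close>

lemma straighten_linear_parts:
  obtains L :: "'n::{finite,linorder} cmat \<Rightarrow> 'n::{finite,linorder} cmat"
    and E :: "'n::{finite,linorder} \<Rightarrow> 'n::{finite,linorder} cmat \<Rightarrow> 'n::{finite,linorder} cmat"
  where "bounded_linear L" "\<And>i. bounded_linear (E i)"
    "\<And>A. straighten A = L A + (\<Sum>i\<in>UNIV. E i (matpow A (pos i)))"
    "\<And>A u. dstraighten A u = L u + (\<Sum>i\<in>UNIV. E i (dmatpow A u (pos i)))"
proof
  let ?L = "\<lambda>A :: 'n cmat. (\<chi> i j. if i = j then of_real (Re (A $ i $ i)) else A $ i $ j) :: 'n cmat"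
  let ?E = "\<lambda>l (A :: 'n cmat). (\<chi> i j. if i = j then if l = i
      then Complex 0 (Re ((- \<i>) ^ pos l * trace A)) else 0 else 0) :: 'n cmat"
  show "bounded_linear ?L"
    unfolding linear_conv_bounded_linear[symmetric]
    by (rule linearI) (auto simp: vec_eq_iff complex_eq_iff)
  show "bounded_linear (?E l)" for l
    unfolding linear_conv_bounded_linear[symmetric]
    by (rule linearI) (auto simp: vec_eq_iff complex_eq_iff trace_def sum.distrib algebra_simps scaleR_sum_right[symmetric])
  show "straighten A = ?L A + (\<Sum>i\<in>UNIV. ?E i (matpow A (pos i)))" for A :: "'n cmat"
    by (auto simp: straighten_def vec_eq_iff Complex_eq)
  show "dstraighten A u = ?L u + (\<Sum>i\<in>UNIV. ?E i (dmatpow A u (pos i)))" for A u :: "'n cmat"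
    by (auto simp: dstraighten_def vec_eq_iff Complex_eq)
qed

lemma has_derivative_straighten: "(straighten has_derivative dstraighten A) (at A)"
proof -
  obtain L :: "'a cmat \<Rightarrow> 'a cmat" and E :: "'a \<Rightarrow> 'a cmat \<Rightarrow> 'a cmat"
    where LE: "bounded_linear L" "\<And>i. bounded_linear (E i)"
    and eq: "\<And>A. straighten A = L A + (\<Sum>i\<in>UNIV. E i (matpow A (pos i)))"
    "\<And>A u. dstraighten A u = L u + (\<Sum>i\<in>UNIV. E i (dmatpow A u (pos i)))"
    by (rule straighten_linear_parts) blast
  have "((\<lambda>A. L A + (\<Sum>i\<in>UNIV. E i (matpow A (pos i)))) has_derivative
      (\<lambda>u. L u + (\<Sum>i\<in>UNIV. E i (dmatpow A u (pos i))))) (at A)"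
    by (intro has_derivative_add has_derivative_sum bounded_linear.has_derivative[OF LE(2)]
        bounded_linear_imp_has_derivative LE(1) has_derivative_matpow)
  then show ?thesis
    unfolding eq[abs_def] by (simp add: eq(1)[abs_def])
qed

lemma continuous_on_dstraighten: "continuous_on S (\<lambda>A. dstraighten A u)"
proof -
  obtain L :: "'a cmat \<Rightarrow> 'a cmat" and E :: "'a \<Rightarrow> 'a cmat \<Rightarrow> 'a cmat"
    where LE: "bounded_linear L" "\<And>i. bounded_linear (E i)"
    and eq: "\<And>A. straighten A = L A + (\<Sum>i\<in>UNIV. E i (matpow A (pos i)))"
    "\<And>A u. dstraighten A u = L u + (\<Sum>i\<in>UNIV. E i (dmatpow A u (pos i)))"
    by (rule straighten_linear_parts) blast
  show ?thesis
    unfolding eq by (intro continuous_on_add continuous_on_const continuous_on_sum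
        bounded_linear.continuous_on[OF LE(2)] continuous_on_dmatpow)
qed

section \<open>Ranks of indices\<close>

lemma pos_le: "pos (i :: 'n::{finite,linorder}) \<le> CARD('n)"
  by (simp add: pos_def card_mono)

lemma pos_ge_1: "1 \<le> pos (i :: 'n::{finite,linorder})"
  by (simp add: pos_def Suc_le_eq card_gt_0_iff)

lemma pos_less_iff: "pos i < pos j \<longleftrightarrow> (i :: 'n::{finite,linorder}) < j"
proof -
  have "pos i < pos j" if "i < j" for i j :: 'n
    unfolding pos_def using that by (intro psubset_card_mono) auto
  then show ?thesis by (metis less_asym less_irrefl linorder_cases)
qed

lemma inj_pos: "inj (pos :: 'n::{finite,linorder} \<Rightarrow> nat)"
  by (metis injI less_irrefl linorder_cases pos_less_iff)

lemma bij_betw_pos: "bij_betw (pos :: 'n::{finite,linorder} \<Rightarrow> nat) UNIV {1..CARD('n)}"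
proof -
  have "range (pos :: 'n \<Rightarrow> nat) = {1..CARD('n)}"
    using pos_le pos_ge_1 inj_pos by (intro card_subset_eq) (auto simp: card_image[OF inj_pos])
  then show ?thesis by (simp add: bij_betw_def inj_pos)
qed

lemma ex_pos_eq:
  assumes "1 \<le> k" "k \<le> CARD('n::{finite,linorder})"
  shows "\<exists>i :: 'n. pos i = k"
proof -
  have "k \<in> range (pos :: 'n \<Rightarrow> nat)"
    using assms unfolding bij_betw_imp_surj_on[OF bij_betw_pos] by simp
  then show ?thesis by auto
qed

text \<open>In the kernel only the imaginary parts of the diagonal of \<open>u\<close> survive. The
  derivatives of the N traces annihilate their power sums against the numbers
  \<open>Im (d i)\<close>, which are distinct, so Vandermonde applies.\<close>

lemma inj_dstraighten_diagm:
  fixes d :: "'n::{finite,linorder} \<Rightarrow> complex"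
  assumes "inj d" and "\<And>i. Re (d i) = 0"
  shows "inj (dstraighten (diagm d))"
proof -
  have "linear (dstraighten (diagm d))"
    using has_derivative_straighten has_derivative_linear by blast
  moreover have "u = 0" if "dstraighten (diagm d) u = 0" for u
  proof -
    have offdiag: "u $ i $ j = 0" if "i \<noteq> j" for i j
      using arg_cong[OF \<open>dstraighten (diagm d) u = 0\<close>, of "\<lambda>A. A $ i $ j"] that
      by (simp add: dstraighten_def)
    have "Re (u $ i $ i) = 0" for i
      using arg_cong[OF \<open>dstraighten (diagm d) u = 0\<close>, of "\<lambda>A. A $ i $ i"]
      by (simp add: dstraighten_def complex_eq_iff)
    then have u: "u $ i $ i = \<i> * of_real (Im (u $ i $ i))" for i
      by (simp add: complex_eq_iff)
    have d: "d i = \<i> * of_real (Im (d i))" for i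
      using assms(2)[of i] by (simp add: complex_eq_iff)
    have "inj (\<lambda>i. Im (d i))"
      using assms(1) d by (metis (no_types, lifting) inj_def)
    moreover have "(\<Sum>i\<in>UNIV. Im (u $ i $ i) * Im (d i) ^ k) = 0" if k: "k < CARD('n)" for k
    proof -
      \<comment> \<open>Differentiating the trace of the power \<open>k + 1\<close> leaves the
        \<open>k\<close>-th power of the nodes, and that trace is stored at the place of rank
        \<open>k + 1\<close>.\<close>
      obtain l :: 'n where l: "pos l = Suc k"
        using ex_pos_eq[of "Suc k", where 'n = 'n] k by auto
      have "0 = Re ((- \<i>) ^ pos l * trace (dmatpow (diagm d) u (pos l)))"
        using arg_cong[OF \<open>dstraighten (diagm d) u = 0\<close>, of "\<lambda>A. A $ l $ l"]
        by (simp add: dstraighten_def complex_eq_iff)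
      also have "(- \<i>) ^ pos l * trace (dmatpow (diagm d) u (pos l)) =
          (\<Sum>i\<in>UNIV. (- \<i>) ^ Suc k * (of_nat (Suc k) * d i ^ k * u $ i $ i))"
        by (simp only: trace_def diag_dmatpow_diagm l sum_distrib_left diff_Suc_1)
      also have "\<dots> = (\<Sum>i\<in>UNIV. of_real (Suc k * (Im (u $ i $ i) * Im (d i) ^ k)))"
      proof (rule sum.cong[OF refl])
        fix i :: 'n
        \<comment> \<open>The \<open>k + 1\<close> factors -i are shared out: \<open>k\<close> of
          them make the powers of \<open>d i\<close> real, the last one makes
          \<open>u $ i $ i\<close> real.\<close>
        have "(- \<i>) ^ Suc k * (of_nat (Suc k) * d i ^ k * u $ i $ i) =
            of_nat (Suc k) * ((- \<i> * d i) ^ k * (- \<i> * u $ i $ i))"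
          by (simp add: power_mult_distrib[of "- \<i>" "d i" k, simplified] algebra_simps power_mult_distrib)
        also have "- \<i> * d i = of_real (Im (d i))"
          by (subst d) simp
        also have "- \<i> * u $ i $ i = of_real (Im (u $ i $ i))"
          by (subst u) simp
        finally show "(- \<i>) ^ Suc k * (of_nat (Suc k) * d i ^ k * u $ i $ i) =
            of_real (Suc k * (Im (u $ i $ i) * Im (d i) ^ k))"
          by (simp add: mult_ac)
      qed
      also have "Re \<dots> = Suc k * (\<Sum>i\<in>UNIV. Im (u $ i $ i) * Im (d i) ^ k)"
        by (simp only: Re_sum Re_complex_of_real sum_distrib_left)
      finally show ?thesis by simp
    qed
    ultimately have "Im (u $ i $ i) = 0" for i
      using power_sums_eq_0_imp_eq_0[of UNIV "\<lambda>i. Im (d i)" "\<lambda>i. Im (u $ i $ i)" i] by auto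
    then have "u $ i $ j = 0" for i j
      using offdiag u by (cases "i = j") auto
    then show "u = 0" by (simp add: vec_eq_iff)
  qed
  ultimately show ?thesis
    by (simp add: linear_injective_0)
qed

text \<open>Real coordinates for skew-Hermitian matrices with zero diagonal: for
  \<open>i < j\<close> the coordinate at \<open>(i, j)\<close> is the real part of the upper entry
  and the one at \<open>(j, i)\<close> its imaginary part. Thus ordered pairs serve as real
  coordinates without any enumeration.\<close>

definition offdiag_mat :: "real^'n::{finite,linorder} offdiag \<Rightarrow> 'n cmat" where
  "offdiag_mat x = (\<chi> i j. if i < j then Complex (x $ Abs_offdiag (i, j)) (x $ Abs_offdiag (j, i))
     else if j < i then - cnj (Complex (x $ Abs_offdiag (j, i)) (x $ Abs_offdiag (i, j))) else 0)"

lemma linear_offdiag_mat: "linear offdiag_mat"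
  by (rule linearI) (auto simp: offdiag_mat_def vec_eq_iff complex_eq_iff)

lemma inj_offdiag_mat:
  assumes "CARD('n::{finite,linorder}) \<ge> 2"
  shows "inj (offdiag_mat :: real^'n offdiag \<Rightarrow> 'n cmat)"
proof -
  \<comment> \<open>This excludes the dummy element of \<open>'n offdiag\<close>, a diagonal pair
    whose coordinate would be invisible to \<open>offdiag_mat\<close>.\<close>
  have two: "\<not> (\<forall>x y :: 'n. x = y)"
  proof
    assume "\<forall>x y :: 'n. x = y"
    then have "CARD('n) \<le> Suc 0"
      by (subst card_le_Suc0_iff_eq) auto
    with assms show False by simp
  qed
  have "x = 0" if "offdiag_mat x = 0" for x :: "real^'n offdiag"
  proof -
    have "x $ p = 0" for p
    proof -
      obtain i j where ij: "Rep_offdiag p = (i, j)"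
        by (cases "Rep_offdiag p")
      then have "i \<noteq> j"
        using Rep_offdiag[of p] two by auto
      have p: "p = Abs_offdiag (i, j)"
        using ij by (metis Rep_offdiag_inverse)
      show ?thesis
      proof (cases "i < j")
        case True
        then show ?thesis
          using arg_cong[OF that, of "\<lambda>A. A $ i $ j"] by (simp add: offdiag_mat_def p complex_eq_iff)
      next
        case False
        then have "j < i" using \<open>i \<noteq> j\<close> by auto
        then show ?thesis
          using arg_cong[OF that, of "\<lambda>A. A $ j $ i"] by (simp add: offdiag_mat_def p complex_eq_iff)
      qed
    qed
    then show ?thesis by (simp add: vec_eq_iff)
  qed
  then show ?thesis
    using linear_injective_0[OF linear_offdiag_mat] by blast
qed

lemma offdiag_mat_skew: "cnj (offdiag_mat x $ j $ i) = - offdiag_mat x $ i $ j"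
  by (auto simp: offdiag_mat_def complex_eq_iff)

lemma offdiag_mat_diag: "offdiag_mat x $ i $ i = 0"
  by (simp add: offdiag_mat_def)

lemma range_offdiag_mat:
  fixes B :: "'n::{finite,linorder} cmat"
  assumes skew: "\<And>i j. cnj (B $ j $ i) = - B $ i $ j" and diag: "\<And>i. B $ i $ i = 0"
  shows "B \<in> range offdiag_mat"
proof
  let ?x = "\<chi> p. let (i, j) = Rep_offdiag p in if i < j then Re (B $ i $ j) else Im (B $ j $ i)"
  have Rep: "Rep_offdiag (Abs_offdiag (i, j)) = (i, j)" if "i \<noteq> j" for i j :: 'n
    using that by (simp add: Abs_offdiag_inverse)
  show "B = offdiag_mat ?x"
  proof -
    have "B $ i $ j = offdiag_mat ?x $ i $ j" for i j
    proof (cases i j rule: linorder_cases)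
      case less
      then show ?thesis by (auto simp: offdiag_mat_def Rep complex_eq_iff dest: less_asym)
    next
      case equal
      then show ?thesis by (simp add: diag offdiag_mat_diag)
    next
      case greater
      have "B $ i $ j = - cnj (B $ j $ i)" by (simp add: skew)
      then show ?thesis using greater by (auto simp: offdiag_mat_def Rep complex_eq_iff dest: less_asym)
    qed
    then show ?thesis by (simp add: vec_eq_iff)
  qed
qed simp

lemma hconj_eq_uminus_iff: "hconj A = - A \<longleftrightarrow> (\<forall>i j. cnj (A $ j $ i) = - A $ i $ j)"
  by (simp add: transpose_def vec_eq_iff)

lemma skew_Re_diag:
  assumes "hconj A = - A"
  shows "Re (A $ i $ i) = 0"
proof -
  have "cnj (A $ i $ i) = - A $ i $ i"
    using assms unfolding hconj_eq_uminus_iff by blast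
  then show ?thesis by (simp add: complex_eq_iff)
qed

lemma straighten_nth_diag:
  "straighten A $ i $ i = Complex (Re (A $ i $ i)) (Re ((- \<i>) ^ pos i * trace (matpow A (pos i))))"
  by (simp add: straighten_def)

lemma straighten_nth_offdiag: "i \<noteq> j \<Longrightarrow> straighten A $ i $ j = A $ i $ j"
  by (simp add: straighten_def)

lemma trace_matpow_eq_iff:
  assumes "hconj A = - A" "hconj D = - D"
  shows "trace (matpow A k) = trace (matpow D k) \<longleftrightarrow>
    Re ((- \<i>) ^ k * trace (matpow A k)) = Re ((- \<i>) ^ k * trace (matpow D k))"
proof
  assume "Re ((- \<i>) ^ k * trace (matpow A k)) = Re ((- \<i>) ^ k * trace (matpow D k))"
  then have "(- \<i>) ^ k * trace (matpow A k) = (- \<i>) ^ k * trace (matpow D k)"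
    using Im_trace_matpow[OF assms(1), of k] Im_trace_matpow[OF assms(2), of k] by (simp add: complex_eq_iff)
  then show "trace (matpow A k) = trace (matpow D k)" by simp
qed simp

text \<open>The equation fixes the diagonal of \<open>straighten A\<close> and leaves a free
  skew-Hermitian off-diagonal part, because \<open>D\<close> has no off-diagonal entries. The fixed
  diagonal says that the diagonal of \<open>A\<close> is imaginary and that all traces of powers
  agree. The equivalence holds for every \<open>A\<close>, not only near \<open>D\<close>.\<close>

lemma orbit_iff_straighten:
  fixes A D :: "'n::{finite,linorder} cmat"
  assumes D: "D \<in> orbit z" and diag: "\<And>i j. i \<noteq> j \<Longrightarrow> D $ i $ j = 0"
  shows "A \<in> orbit z \<longleftrightarrow> (\<exists>x. straighten A = straighten D + offdiag_mat x)"
proof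
  have D': "hconj D = - D" "trace D = 0" "moments D = z"
    using D by (auto simp: orbit_def su_def)
  have D_re: "Re (D $ i $ i) = 0" for i :: 'n
    by (rule skew_Re_diag[OF D'(1)])
  assume A: "A \<in> orbit z"
  then have A': "hconj A = - A" "trace A = 0" "moments A = z"
    by (auto simp: orbit_def su_def)
  have A_skew: "cnj (A $ j $ i) = - A $ i $ j" for i j
    using A'(1) by (simp add: hconj_eq_uminus_iff)
  have A_re: "Re (A $ i $ i) = 0" for i
    using A_skew[of i i] by (simp add: complex_eq_iff)
  have "trace (matpow A (pos i)) = trace (matpow D (pos i))" for i :: 'n
  \<comment> \<open>\<open>moments\<close> starts with the second power; the first power is the
    trace, which vanishes on \<open>su\<close>.\<close>
  proof (cases "pos i = 1")
    case False
    then have "pos i \<in> {2..CARD('n)}" using pos_ge_1[of i] pos_le[of i] by simp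
    then show ?thesis
      using A'(3) D'(3) by (metis moments_def)
  qed (simp add: A' D')
  then have "(straighten A - straighten D) $ i $ i = 0" for i
    by (simp add: straighten_nth_diag A_re D_re)
  moreover have "cnj ((straighten A - straighten D) $ j $ i) = - (straighten A - straighten D) $ i $ j" for i j
    using calculation[of i] A_skew[of j i] diag[of i j] diag[of j i]
    by (cases "i = j") (simp_all add: straighten_nth_offdiag)
  ultimately obtain x where "straighten A - straighten D = offdiag_mat x"
    using range_offdiag_mat by blast
  then show "\<exists>x. straighten A = straighten D + offdiag_mat x"
    by (metis add.commute diff_add_cancel)
next
  have D': "hconj D = - D" "trace D = 0" "moments D = z"
    using D by (auto simp: orbit_def su_def)
  have D_re: "Re (D $ i $ i) = 0" for i :: 'n
    by (rule skew_Re_diag[OF D'(1)])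
  assume "\<exists>x. straighten A = straighten D + offdiag_mat x"
  then obtain x where x: "\<And>i j. straighten A $ i $ j = straighten D $ i $ j + offdiag_mat x $ i $ j"
    by auto
  have A_re: "Re (A $ i $ i) = 0" for i
    using x[of i i] by (simp add: straighten_nth_diag offdiag_mat_diag D_re)
  have skew: "cnj (A $ j $ i) = - A $ i $ j" for i j
  proof (cases "i = j")
    case True
    then show ?thesis using A_re[of i] by (simp add: complex_eq_iff)
  next
    case False
    then show ?thesis
      using x[of i j] x[of j i] offdiag_mat_skew[of x j i] diag[of i j] diag[of j i] by (simp add: straighten_nth_offdiag)
  qed
  then have A: "hconj A = - A" by (simp add: hconj_eq_uminus_iff)
  \<comment> \<open>The straightened diagonal records only a real part, so skewness of
    \<open>A\<close> had to come before the full traces can be compared.\<close>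
  have tr: "trace (matpow A (pos i)) = trace (matpow D (pos i))" for i :: 'n
    using x[of i i] unfolding trace_matpow_eq_iff[OF A D'(1)]
    by (simp add: straighten_nth_diag offdiag_mat_diag)
  have tr: "trace (matpow A k) = trace (matpow D k)" if "1 \<le> k" "k \<le> CARD('n)" for k
    using tr ex_pos_eq[OF that] by metis
  have "trace A = 0"
    using tr[of 1] D'(2) by (simp add: Suc_le_eq)
  moreover have "moments A = moments D"
    using tr by (auto simp: moments_def fun_eq_iff)
  ultimately show "A \<in> orbit z"
    using A D' by (simp add: orbit_def su_def)
qed

text \<open>The chart is the local inverse \<open>g\<close> of \<open>straighten\<close>, restricted
  to the affine slice through \<open>straighten (diagm d)\<close> in the directions
  \<open>offdiag_mat x\<close>. The characterization of the orbit by this slice identifies the image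
  as the whole of the orbit inside \<open>S\<close>.\<close>

lemma ex_orbit_chart_diagm:
  fixes d :: "'n::{finite,linorder} \<Rightarrow> complex"
  assumes card: "CARD('n) \<ge> 2" and "inj d" and D: "diagm d \<in> orbit z"
  shows "\<exists>U \<phi> \<phi>' S. orbit_chart z U \<phi> \<phi>' \<and> open S \<and> diagm d \<in> S \<and> \<phi> ` U = orbit z \<inter> S"
proof -
  let ?D = "diagm d :: 'n cmat"
  have "hconj ?D = - ?D"
    using D by (simp add: orbit_def su_def)
  then have "cnj (?D $ i $ i) = - ?D $ i $ i" for i
    unfolding hconj_eq_uminus_iff by blast
  then have Re_d: "Re (d i) = 0" for i
    by (simp add: diagm_def complex_eq_iff)
  have bl: "bounded_linear (dstraighten A)" for A :: "'n cmat"
    using has_derivative_straighten has_derivative_bounded_linear by blast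
  define F where "F A = Blinfun (dstraighten A)" for A :: "'n cmat"
  have F: "blinfun_apply (F A) = dstraighten A" for A
    using bl by (simp add: F_def bounded_linear_Blinfun_apply)
  have F_cont: "continuous_on UNIV F"
    by (rule continuous_on_blinfun_componentwise) (simp add: F continuous_on_dstraighten)
  \<comment> \<open>Injectivity of the derivative gives a left inverse, which is the form of
    invertibility that the inverse function theorem consumes.\<close>
  obtain h where h: "linear h" "h \<circ> dstraighten ?D = id"
    using linear_injective_left_inverse[OF bounded_linear.linear[OF bl] inj_dstraighten_diagm[OF \<open>inj d\<close> Re_d]]
    by blast
  have "bounded_linear h" using h(1) linear_conv_bounded_linear by blast
  then have inv: "Blinfun h o\<^sub>L F ?D = id_blinfun"
    using h(2) by (intro blinfun_eqI) (simp add: bounded_linear_Blinfun_apply F fun_eq_iff)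
  obtain S V g g' where S: "open S" "?D \<in> S" and V: "open V"
    and hom: "homeomorphism S V straighten g"
    and g: "\<And>y. y \<in> V \<Longrightarrow> (g has_derivative (g' y)) (at y)"
    and g': "\<And>y. y \<in> V \<Longrightarrow> g' y = inv (blinfun_apply (F (g y)))"
    and bij: "\<And>y. y \<in> V \<Longrightarrow> bij (blinfun_apply (F (g y)))"
    by (rule inverse_function_theorem[of UNIV straighten F ?D "Blinfun h"])
       (use F_cont inv has_derivative_straighten in \<open>auto simp: F\<close>)
  define a where "a x = straighten ?D + offdiag_mat x" for x
  have off_bl: "bounded_linear (offdiag_mat :: real^'n offdiag \<Rightarrow> 'n cmat)"
    using linear_offdiag_mat linear_conv_bounded_linear by blast
  have a: "(a has_derivative offdiag_mat) (at x)" for x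
    unfolding a_def[abs_def]
    by (rule has_derivative_eq_rhs) (rule derivative_intros bounded_linear_imp_has_derivative[OF off_bl] | simp)+
  have a_cont: "continuous_on T a" for T
    using a by (meson has_derivative_at_withinI has_derivative_continuous_on)
  define U where "U = a -` V"
  define \<phi> where "\<phi> = g \<circ> a"
  define \<phi>' where "\<phi>' x v = g' (a x) (offdiag_mat v)" for x v
  have aV: "a x \<in> V" if "x \<in> U" for x using that by (simp add: U_def)
  have gV: "g y \<in> S" "straighten (g y) = y" if "y \<in> V" for y
    using hom that by (auto simp: homeomorphism_def)
  have inj_g': "inj (g' y)" if "y \<in> V" for y
    using g'[OF that] bij[OF that] by (simp add: bij_imp_bij_inv bij_is_inj)
  have orbit_iff: "A \<in> orbit z \<longleftrightarrow> (\<exists>x. straighten A = a x)" for A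
    unfolding a_def by (rule orbit_iff_straighten[OF D]) (simp add: diagm_def)
  have inj_off: "inj (offdiag_mat :: real^'n offdiag \<Rightarrow> 'n cmat)"
    by (rule inj_offdiag_mat[OF card])
  have "orbit_chart z U \<phi> \<phi>'"
    unfolding orbit_chart_def
  proof (intro conjI ballI allI)
    show "open U"
      unfolding U_def by (rule open_vimage[OF V a_cont])
    show "inj_on \<phi> U"
    proof (rule inj_onI)
      fix x y assume "x \<in> U" "y \<in> U" "\<phi> x = \<phi> y"
      then have "a x = a y" using gV(2)[of "a x"] gV(2)[of "a y"] aV by (metis \<phi>_def comp_apply)
      then show "x = y" using inj_off by (simp add: a_def inj_eq)
    qed
    show "\<phi> ` U \<subseteq> orbit z"
      using gV aV by (auto simp: orbit_iff \<phi>_def)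
    show "(\<phi> has_derivative \<phi>' x) (at x)" if "x \<in> U" for x
      using diff_chain_at[OF a g[OF aV[OF that]]] by (simp add: \<phi>_def \<phi>'_def[abs_def] comp_def)
    show "inj (\<phi>' x)" if "x \<in> U" for x
      using inj_compose[OF inj_g'[OF aV[OF that]] inj_off] by (simp add: \<phi>'_def[abs_def] comp_def)
    show "continuous_on U (\<lambda>x. \<phi>' x v)" for v
    proof -
      have "continuous_on V g" using hom by (simp add: homeomorphism_def)
      then have "continuous_on V (\<lambda>y. F (g y))"
        by (intro continuous_on_compose2[OF F_cont]) auto
      then have "continuous_on V (\<lambda>y. inv (blinfun_apply (F (g y))) (offdiag_mat v))"
        using bij by (rule continuous_on_inv_blinfun_apply)
      then have "continuous_on U (\<lambda>x. inv (blinfun_apply (F (g (a x)))) (offdiag_mat v))"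
        by (rule continuous_on_compose2[OF _ a_cont]) (auto simp: U_def)
      then show ?thesis
        by (rule continuous_on_eq) (simp add: \<phi>'_def g' aV)
    qed
  qed
  moreover have "\<phi> ` U = orbit z \<inter> S"
  proof
    show "\<phi> ` U \<subseteq> orbit z \<inter> S"
      using gV aV by (auto simp: orbit_iff \<phi>_def)
    show "orbit z \<inter> S \<subseteq> \<phi> ` U"
    proof
      fix A assume A: "A \<in> orbit z \<inter> S"
      then obtain x where x: "straighten A = a x" using orbit_iff by blast
      have "straighten A \<in> V" "g (straighten A) = A"
        using hom A by (auto simp: homeomorphism_def)
      then have "x \<in> U" "\<phi> x = A" using x by (simp_all add: U_def \<phi>_def)
      then show "A \<in> \<phi> ` U" by blast
    qed
  qed
  ultimately show ?thesis using S by blast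
qed

section \<open>Transport of charts by unitary conjugation\<close>

lemma conj_matpow:
  assumes "W ** V = mat 1" "V ** W = mat 1"
  shows "matpow (V ** A ** W) k = V ** matpow A k ** W"
proof (induction k)
  case (Suc k)
  have "matpow (V ** A ** W) (Suc k) = V ** A ** (W ** V) ** matpow A k ** W"
    by (simp add: Suc matrix_mul_assoc)
  then show ?case by (simp add: assms matrix_mul_assoc)
qed (simp add: assms)

lemma conj_in_orbit:
  assumes V: "hconj V ** V = mat 1" "V ** hconj V = mat 1" and A: "A \<in> orbit z"
  shows "V ** A ** hconj V \<in> orbit z"
proof -
  let ?B = "V ** A ** hconj V"
  have tr: "trace (V ** X ** hconj V) = trace X" for X
  proof -
    have "trace (V ** X ** hconj V) = trace (hconj V ** (V ** X))"
      by (rule trace_mul_sym)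
    then show ?thesis by (simp add: matrix_mul_assoc V)
  qed
  have "hconj ?B = V ** hconj A ** hconj V"
    by (simp add: hconj_mult matrix_mul_assoc)
  also have "hconj A = - A" using A by (simp add: orbit_def su_def)
  also have "V ** - A ** hconj V = - ?B"
    by (simp add: vec_eq_iff matrix_matrix_mult_def sum_negf)
  finally have "hconj ?B = - ?B" .
  moreover have "moments ?B = moments A"
    by (auto simp: moments_def conj_matpow[OF V] tr)
  ultimately show ?thesis
    using A by (simp add: orbit_def su_def tr)
qed

lemma ex_orbit_chart:
  fixes A :: "'n::{finite,linorder} cmat"
  assumes card: "CARD('n) \<ge> 2" and A: "A \<in> orbit z" and ev: "card (eigenvalues A) = CARD('n)"
  shows "\<exists>U \<phi> \<phi>' S. orbit_chart z U \<phi> \<phi>' \<and> open S \<and> A \<in> S \<and> \<phi> ` U = orbit z \<inter> S"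
proof -
  have "A \<in> su" using A by (simp add: orbit_def)
  then obtain V d where V: "hconj V ** V = mat 1" "V ** hconj V = mat 1"
    and "inj d" and A_eq: "A = V ** diagm d ** hconj V"
    by (rule su_regular_diagonalizable[OF _ ev])
  define c where "c X = V ** X ** hconj V" for X
  define c' where "c' X = hconj V ** X ** V" for X
  have c'c: "c' (c X) = X" for X
  proof -
    have "c' (c X) = (hconj V ** V) ** X ** (hconj V ** V)"
      by (simp add: c_def c'_def matrix_mul_assoc)
    then show ?thesis by (simp add: V)
  qed
  have cc': "c (c' X) = X" for X
  proof -
    have "c (c' X) = (V ** hconj V) ** X ** (V ** hconj V)"
      by (simp add: c_def c'_def matrix_mul_assoc)
    then show ?thesis by (simp add: V)
  qed
  have c_orbit: "c X \<in> orbit z" if "X \<in> orbit z" for X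
    unfolding c_def by (rule conj_in_orbit[OF V that])
  have c'_orbit: "c' X \<in> orbit z" if "X \<in> orbit z" for X
    using conj_in_orbit[of "hconj V" X z] V that by (simp add: c'_def)
  have bl: "bounded_linear (\<lambda>X. P ** X ** Q)" for P Q :: "'n cmat"
    by (rule bounded_linear_compose[OF bounded_bilinear.bounded_linear_left[OF bounded_bilinear_matrix_mult]
          bounded_bilinear.bounded_linear_right[OF bounded_bilinear_matrix_mult]])
  then have c_bl: "bounded_linear c" and c'_bl: "bounded_linear c'"
    by (simp_all add: c_def[abs_def] c'_def[abs_def])
  have A_c: "A = c (diagm d)" by (simp add: A_eq c_def)
  have D: "diagm d \<in> orbit z"
    using c'_orbit[OF A] by (simp add: A_c c'c)
  obtain U \<phi> \<phi>' S where chart: "orbit_chart z U \<phi> \<phi>'" and S: "open S" "diagm d \<in> S"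
    and im: "\<phi> ` U = orbit z \<inter> S"
    using ex_orbit_chart_diagm[OF card \<open>inj d\<close> D] by (elim exE conjE)
  have inj_c: "inj c" by (metis c'c injI)
  have "orbit_chart z U (\<lambda>x. c (\<phi> x)) (\<lambda>x v. c (\<phi>' x v))"
    unfolding orbit_chart_def
  proof (intro conjI ballI allI)
    show "open U" "inj_on (\<lambda>x. c (\<phi> x)) U"
      using chart inj_c by (auto simp: orbit_chart_def inj_on_def)
    show "(\<lambda>x. c (\<phi> x)) ` U \<subseteq> orbit z"
      using chart c_orbit by (auto simp: orbit_chart_def)
    show "((\<lambda>x. c (\<phi> x)) has_derivative (\<lambda>v. c (\<phi>' x v))) (at x)" if "x \<in> U" for x
      using chart that by (auto simp: orbit_chart_def intro: bounded_linear.has_derivative[OF c_bl])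
    show "inj (\<lambda>v. c (\<phi>' x v))" if "x \<in> U" for x
      using chart that inj_c by (auto simp: orbit_chart_def inj_def)
    show "continuous_on U (\<lambda>x. c (\<phi>' x v))" for v
      using chart by (auto simp: orbit_chart_def intro: bounded_linear.continuous_on[OF c_bl])
  qed
  \<comment> \<open>The moved neighbourhood is written as a preimage under the inverse conjugation,
    so that its openness is just continuity.\<close>
  moreover have "open (c' -` S)"
    using S(1) by (rule open_vimage) (intro bounded_linear.continuous_on[OF c'_bl] continuous_on_id)
  moreover have "A \<in> c' -` S" using S(2) by (simp add: A_c c'c)
  moreover have "(\<lambda>x. c (\<phi> x)) ` U = orbit z \<inter> c' -` S"
  proof -
    have "(\<lambda>x. c (\<phi> x)) ` U = c ` (orbit z \<inter> S)"
      unfolding im[symmetric] by (rule image_image[symmetric])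
    also have "\<dots> = orbit z \<inter> c' -` S"
    proof
      show "c ` (orbit z \<inter> S) \<subseteq> orbit z \<inter> c' -` S"
        using c_orbit by (auto simp: c'c)
      show "orbit z \<inter> c' -` S \<subseteq> c ` (orbit z \<inter> S)"
      proof
        fix X assume "X \<in> orbit z \<inter> c' -` S"
        then have "c' X \<in> orbit z \<inter> S" using c'_orbit by simp
        then show "X \<in> c ` (orbit z \<inter> S)" using cc'[of X] by (metis imageI)
      qed
    qed
    finally show ?thesis .
  qed
  ultimately show ?thesis by blast
qed

section \<open>The modes\<close>

lemma cscale_nth [simp]: "(c *\<^sub>C A) $ i $ j = c * A $ i $ j"
  by (simp add: cscale_def)

lemma trace_cscale: "trace (c *\<^sub>C A) = c * trace A"
  by (simp add: trace_def sum_distrib_left)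

lemma omega_neq_0 [simp]: "omega N \<noteq> 0"
  by (simp add: omega_def)

lemma cnj_omega: "cnj (omega N) = inverse (omega N)"
proof -
  have "cnj (omega N) = exp (- (- 4 * pi * \<i> / N))"
    by (simp add: omega_def exp_cnj)
  then show ?thesis
    by (simp add: omega_def exp_minus)
qed

text \<open>\<open>omega N\<close> is the inverse square of the standard primitive root of unity;
  for odd \<open>N\<close> the factor 2 is coprime to \<open>N\<close> and so does not lower the
  order.\<close>

lemma omega_powi_eq_1_iff:
  assumes "odd N"
  shows "omega N powi a = 1 \<longleftrightarrow> int N dvd a"
proof -
  have N: "N > 0" using assms by (cases N) auto
  have "omega N powi a = exp (of_int a * (- 4 * pi * \<i> / N))"
    by (simp add: omega_def exp_power_int)
  also have "\<dots> = 1 \<longleftrightarrow> (\<exists>n::int. of_int a * (- 4 * pi / N) = of_int (2 * n) * pi)"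
    by (simp add: exp_eq_1)
  also have "\<dots> \<longleftrightarrow> (\<exists>n::int. - 2 * a = n * int N)"
  proof (rule ex_cong1)
    fix n :: int
    have "of_int a * (- 4 * pi / N) = of_int (2 * n) * pi \<longleftrightarrow> real_of_int (- 2 * a) = of_int (n * int N)"
    proof -
      have "of_int a * (- 4 * pi / N) = of_int (2 * n) * pi \<longleftrightarrow> (2 * pi / N) * real_of_int (- 2 * a) = (2 * pi / N) * of_int (n * int N)"
        using N by (simp add: field_simps)
      also have "\<dots> \<longleftrightarrow> real_of_int (- 2 * a) = of_int (n * int N)"
        using N by (subst mult_cancel_left) simp
      finally show ?thesis .
    qed
    then show "of_int a * (- 4 * pi / N) = of_int (2 * n) * pi \<longleftrightarrow> - 2 * a = n * int N"
      by (simp only: of_int_eq_iff)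
  qed
  also have "\<dots> \<longleftrightarrow> int N dvd - 2 * a"
    by (auto simp: dvd_def mult.commute)
  also have "\<dots> \<longleftrightarrow> int N dvd a"
    using assms by (simp add: coprime_dvd_mult_right_iff)
  finally show ?thesis .
qed

lemma omega_powi_eq_iff:
  assumes "odd N"
  shows "omega N powi a = omega N powi b \<longleftrightarrow> int N dvd a - b"
  using omega_powi_eq_1_iff[OF assms, of "a - b"] by (simp add: power_int_diff)

lemma omega_powi_cong:
  assumes "odd N" "[a = b] (mod int N)"
  shows "omega N powi a = omega N powi b"
  using assms by (simp add: omega_powi_eq_iff cong_iff_dvd_diff)

lemma matpow_clock:
  "matpow clock k = (diagm (\<lambda>i. omega CARD('n) ^ ((pos i - 1) * k)) :: 'n::{finite,linorder} cmat)"
proof -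
  have clock: "(clock :: 'n cmat) = diagm (\<lambda>i. omega CARD('n) ^ (pos i - 1))"
    unfolding clock_def diagm_def ..
  show ?thesis unfolding clock matpow_diagm power_mult ..
qed

text \<open>Two ranks differ by less than N. Indices may therefore be treated as residue classes,
  which absorbs the wrap-around of the shift.\<close>

lemma cong_pos_iff:
  "[int (pos i) = int (pos j)] (mod int CARD('n)) \<longleftrightarrow> i = (j :: 'n::{finite,linorder})"
proof
  assume "[int (pos i) = int (pos j)] (mod int CARD('n))"
  then have dvd: "int CARD('n) dvd int (pos i) - int (pos j)"
    by (simp add: cong_iff_dvd_diff)
  have "\<bar>int (pos i) - int (pos j)\<bar> < int CARD('n)"
    using pos_le[of i] pos_le[of j] pos_ge_1[of i] pos_ge_1[of j] by linarith
  with dvd have "int (pos i) - int (pos j) = 0"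
    using zdvd_not_zless[of "\<bar>int (pos i) - int (pos j)\<bar>" "int CARD('n)"] by (auto simp: dvd_abs_iff)
  then have "pos i = pos j" by simp
  then show "i = j" by (rule injD[OF inj_pos])
qed simp

lemma ex1_pos_cong: "\<exists>j :: 'n::{finite,linorder}. [int (pos j) = a] (mod int CARD('n))"
proof -
  \<comment> \<open>Ranks run from 1 to N and remainders from 0 to N - 1, hence the displacement by
    one before and after \<open>mod\<close>.\<close>
  define k where "k = nat ((a - 1) mod int CARD('n)) + 1"
  have b: "0 \<le> (a - 1) mod int CARD('n)" "(a - 1) mod int CARD('n) < int CARD('n)" by simp_all
  then have "1 \<le> k" "k \<le> CARD('n)" unfolding k_def by linarith+
  then obtain j :: 'n where "pos j = k" using ex_pos_eq by blast
  then have "int (pos j) = (a - 1) mod int CARD('n) + 1" using b by (simp add: k_def)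
  then have "[int (pos j) = (a - 1) + 1] (mod int CARD('n))"
    by (metis cong_add_rcancel cong_mod_left cong_refl)
  then show ?thesis by auto
qed

text \<open>As a congruence, the superdiagonal and the corner entry are one case, and powers of the
  shift only change the displacement.\<close>

lemma shift_nth:
  "shift $ i $ j = (if [int (pos j) = int (pos i) + 1] (mod int CARD('n)) then 1 else 0)"
  for i j :: "'n::{finite,linorder}"
proof -
  have "[int (pos j) = int (pos i) + 1] (mod int CARD('n)) \<longleftrightarrow>
      pos j = pos i + 1 \<or> (pos i = CARD('n) \<and> pos j = 1)"
  proof (cases "pos i = CARD('n)")
    case True
    then have "pos j \<noteq> pos i + 1" using pos_le[of j] by simp
    obtain l :: 'n where l: "pos l = 1" using ex_pos_eq[of 1] by (auto simp: Suc_le_eq)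
    have "[int (pos i) + 1 = int (pos l)] (mod int CARD('n))"
      by (simp add: True l cong_def)
    then have "[int (pos j) = int (pos i) + 1] (mod int CARD('n)) \<longleftrightarrow> [int (pos j) = int (pos l)] (mod int CARD('n))"
      by (simp add: cong_def)
    then show ?thesis
      using True \<open>pos j \<noteq> pos i + 1\<close> l unfolding cong_pos_iff by (metis injD[OF inj_pos])
  next
    case False
    then obtain l :: 'n where l: "pos l = pos i + 1"
      using ex_pos_eq[of "pos i + 1", where 'n = 'n] pos_le[of i] by auto
    have "[int (pos j) = int (pos i) + 1] (mod int CARD('n)) \<longleftrightarrow> [int (pos j) = int (pos l)] (mod int CARD('n))"
      by (simp add: l add.commute)
    then show ?thesis
      using False l unfolding cong_pos_iff by (metis injD[OF inj_pos])
  qed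
  then show ?thesis by (simp add: shift_def)
qed

lemma matpow_shift_nth:
  "matpow shift k $ i $ j = (if [int (pos j) = int (pos i) + int k] (mod int CARD('n)) then 1 else 0)"
  for i j :: "'n::{finite,linorder}"
proof (induction k arbitrary: i)
  case 0
  show ?case by (auto simp: mat_def cong_pos_iff)
next
  case (Suc k)
  obtain l :: 'n where l: "[int (pos l) = int (pos i) + 1] (mod int CARD('n))"
    using ex1_pos_cong by blast
  then have shift: "shift $ i $ a = (if a = l then 1 else 0)" for a :: 'n
    using cong_pos_iff[of a l] unfolding shift_nth by (simp add: cong_def)
  have "matpow shift (Suc k) $ i $ j = matpow shift k $ l $ j"
    by (simp add: matrix_matrix_mult_def shift if_distrib if_distribR cong: if_cong)
  moreover have "[int (pos l) + int k = int (pos i) + int (Suc k)] (mod int CARD('n))"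
    using cong_add[OF l cong_refl[of "int k"]] by (simp add: algebra_simps)
  ultimately show ?case
    unfolding Suc by (simp add: cong_def)
qed

definition half :: "nat \<Rightarrow> int" where
  "half N = (int N + 1) div 2"

text \<open>A diagonal matrix times a permutation matrix has one nonzero entry per row. Keeping the
  exponent an integer turns identities between modes into divisibility by N.\<close>

lemma Jmat_nth:
  fixes i j :: "'n::{finite,linorder}"
  assumes odd: "odd CARD('n)"
  shows "Jmat (a, b) $ i $ j = (if [int (pos j) = int (pos i) + b] (mod int CARD('n))
    then omega CARD('n) powi (half CARD('n) * a * b + a * (int (pos i) - 1)) else 0)"
proof -
  let ?N = "CARD('n)" and ?w = "omega CARD('n)"
  let ?a = "nat (a mod int ?N)" and ?b = "nat (b mod int ?N)"
  have b: "[int (pos j) = int (pos i) + int ?b] (mod int ?N) \<longleftrightarrow> [int (pos j) = int (pos i) + b] (mod int ?N)"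
    by (simp add: cong_def mod_simps)
  have "?w ^ ((pos i - 1) * ?a) = ?w powi int ((pos i - 1) * ?a)"
    by (rule power_int_of_nat[symmetric])
  also have "\<dots> = ?w powi (a * (int (pos i) - 1))"
  proof (rule omega_powi_cong[OF odd])
    have "int (pos i - 1) = int (pos i) - 1"
      using pos_ge_1[of i] by linarith
    then have "int ((pos i - 1) * ?a) = (int (pos i) - 1) * (a mod int ?N)"
      by (simp only: of_nat_mult) simp
    then show "[int ((pos i - 1) * ?a) = a * (int (pos i) - 1)] (mod int ?N)"
      by (simp only: cong_def mod_simps mult.commute)
  qed
  finally have w: "?w ^ ((pos i - 1) * ?a) = ?w powi (a * (int (pos i) - 1))" .
  have "Jmat (a, b) $ i $ j =
      ?w powi (half ?N * (a * b)) * (?w ^ ((pos i - 1) * ?a) * matpow shift ?b $ i $ j)"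
    by (simp add: Jmat_def matpow_clock half_def matrix_matrix_mult_def diagm_def if_distrib if_distribR cong: if_cong)
  then show ?thesis
    unfolding matpow_shift_nth b w by (simp add: power_int_add mult.assoc)
qed

section \<open>Symmetries of the mode set and of the basis\<close>

definition flip :: "int \<times> int \<Rightarrow> int \<times> int" where
  "flip k = (fst k, - snd k)"

text \<open>The zero mode contributes a multiple of the identity. For odd N the enlarged set has N^2
  elements and indexes a basis of all complex matrices.\<close>

definition all_modes :: "nat \<Rightarrow> (int \<times> int) set" where
  "all_modes N = (let m = (int N - 1) div 2 in {-m..m} \<times> {-m..m})"

lemma modes_eq: "modes N = all_modes N - {(0, 0)}"
  by (simp add: modes_def all_modes_def Let_def)

lemma finite_modes [simp]: "finite (modes N)"
  by (simp add: modes_def Let_def)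

lemma wavenumber_flip [simp]: "wavenumber (flip k) = wavenumber k"
  by (simp add: wavenumber_def flip_def)

lemma wavenumber_uminus [simp]: "wavenumber (- k) = wavenumber k"
  by (simp add: wavenumber_def)

lemma wavenumber_pos: "k \<in> modes N \<Longrightarrow> wavenumber k > 0"
  by (cases k) (auto simp: wavenumber_def modes_def Let_def sum_power2_gt_zero_iff)

lemma flip_flip [simp]: "flip (flip k) = k"
  by (simp add: flip_def)

lemma flip_in_modes [simp]: "flip k \<in> modes N \<longleftrightarrow> k \<in> modes N"
  by (cases k) (auto simp: flip_def modes_def Let_def)

lemma uminus_in_modes [simp]: "- k \<in> modes N \<longleftrightarrow> k \<in> modes N"
  by (cases k) (auto simp: modes_def Let_def)

lemma sum_modes_flip: "(\<Sum>k\<in>modes N. f (flip k)) = (\<Sum>k\<in>modes N. f k)"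
  by (rule sum.reindex_bij_witness[of _ flip flip]) auto

lemma sum_modes_uminus: "(\<Sum>k\<in>modes N. f (- k)) = (\<Sum>k\<in>modes N. f k)"
  by (rule sum.reindex_bij_witness[of _ uminus uminus]) auto

lemma cong_add_iff_cong_diff: "[a = b + c] (mod n) \<longleftrightarrow> [b = a - c] (mod (n :: int))"
  by (metis cong_diff_iff_cong_0 cong_sym_eq diff_diff_eq2 add.commute diff_add_eq)

text \<open>Both sides are nonzero in the same places. There the two exponents differ by
  \<open>2 * half N * a * b - a * (pos i - pos j)\<close>, where \<open>2 * half N\<close> is 1 and
  the difference of ranks is \<open>b\<close> modulo N, so the terms cancel.\<close>

lemma transpose_Jmat:
  assumes odd: "odd CARD('n::{finite,linorder})"
  shows "transpose (Jmat k :: 'n cmat) = Jmat (flip k)"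
proof -
  obtain a b where k: "k = (a, b)" by (cases k)
  have half: "2 * half CARD('n) = int CARD('n) + 1"
    using odd unfolding half_def by presburger
  have "(Jmat (a, b) :: 'n cmat) $ j $ i = Jmat (a, - b) $ i $ j" for i j :: 'n
  proof (cases "[int (pos i) = int (pos j) + b] (mod int CARD('n))")
    case True
    then have c: "[int (pos j) = int (pos i) + - b] (mod int CARD('n))"
      using cong_add_iff_cong_diff[of "int (pos i)" "int (pos j)" b] by simp
    obtain q where q: "int (pos i) - int (pos j) - b = int CARD('n) * q"
      using True unfolding cong_iff_dvd_diff by (auto simp: diff_diff_eq)
    have "half CARD('n) * a * b + a * (int (pos j) - 1) - (half CARD('n) * a * - b + a * (int (pos i) - 1))
        = (2 * half CARD('n)) * (a * b) + a * (int (pos j) - int (pos i))"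
      by (simp add: algebra_simps)
    also have "\<dots> = (int CARD('n) + 1) * (a * b) - a * (int CARD('n) * q + b)"
      unfolding half q[symmetric] by (simp add: algebra_simps)
    also have "\<dots> = int CARD('n) * (a * b - a * q)"
      by (simp add: algebra_simps)
    finally have "omega CARD('n) powi (half CARD('n) * a * b + a * (int (pos j) - 1)) =
        omega CARD('n) powi (half CARD('n) * a * - b + a * (int (pos i) - 1))"
      unfolding omega_powi_eq_iff[OF odd] by simp
    then show ?thesis
      by (simp only: Jmat_nth[OF odd] True c if_True)
  next
    case False
    then have "\<not> [int (pos j) = int (pos i) + - b] (mod int CARD('n))"
      using cong_add_iff_cong_diff[of "int (pos i)" "int (pos j)" b] by simp
    with False show ?thesis
      by (simp only: Jmat_nth[OF odd] if_False)
  qed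
  then show ?thesis
    by (simp add: vec_eq_iff transpose_def k flip_def)
qed

lemma cnj_omega_powi: "cnj (omega N powi a) = omega N powi (- a)"
proof -
  have "cnj (omega N powi a) = inverse (omega N) powi a"
    by (simp add: power_int_def cnj_omega)
  then show ?thesis
    by (simp add: power_int_inverse power_int_minus)
qed

lemma hconj_Jmat:
  assumes odd: "odd CARD('n::{finite,linorder})"
  shows "hconj (Jmat k :: 'n cmat) = Jmat (- k)"
proof -
  obtain a b where k: "k = (a, b)" by (cases k)
  have "cnj ((Jmat (a, b) :: 'n cmat) $ j $ i) = Jmat (- a, - b) $ i $ j" for i j :: 'n
  proof -
    have "cnj ((Jmat (a, b) :: 'n cmat) $ j $ i) = cnj (Jmat (a, - b) $ i $ j)"
      using arg_cong[OF transpose_Jmat[OF odd, of "(a, b)"], of "\<lambda>A. A $ i $ j"]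
      by (simp add: transpose_def flip_def)
    also have "\<dots> = Jmat (- a, - b) $ i $ j"
    proof -
      have "- (half CARD('n) * a * - b + a * (int (pos i) - 1)) =
          half CARD('n) * - a * - b + - a * (int (pos i) - 1)"
        by simp
      then show ?thesis
        by (simp only: Jmat_nth[OF odd] if_distrib[of cnj] cnj_omega_powi complex_cnj_zero)
    qed
    finally show ?thesis .
  qed
  then show ?thesis
    by (simp add: vec_eq_iff transpose_def k)
qed

lemma transpose_Lmat:
  assumes "odd CARD('n::{finite,linorder})"
  shows "transpose (Lmat k :: 'n cmat) = Lmat (flip k)"
  unfolding Lmat_def transpose_Jmat[OF assms, symmetric] by (simp add: vec_eq_iff transpose_def)

text \<open>The sign comes from the imaginary normalization 1 / (4 pi i) in
  \<open>Lmat\<close>.\<close>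

lemma hconj_Lmat:
  assumes "odd CARD('n::{finite,linorder})"
  shows "hconj (Lmat k :: 'n cmat) = - Lmat (- k)"
  unfolding Lmat_def hconj_Jmat[OF assms, symmetric] by (simp add: vec_eq_iff transpose_def)

text \<open>A nonzero displacement \<open>b\<close> leaves the diagonal empty; for
  \<open>b = 0\<close> the trace is a geometric sum over a nontrivial N-th root of unity.\<close>

lemma trace_Lmat:
  assumes odd: "odd CARD('n::{finite,linorder})" and k: "k \<in> modes CARD('n)"
  shows "trace (Lmat k :: 'n cmat) = 0"
proof -
  let ?N = "int CARD('n)"
  obtain a b where ab: "k = (a, b)" by (cases k)
  define m where "m = (?N - 1) div 2"
  have "2 * m < ?N" by (simp add: m_def)
  have ab_le: "\<bar>a\<bar> \<le> m" "\<bar>b\<bar> \<le> m" "a \<noteq> 0 \<or> b \<noteq> 0"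
    using k by (auto simp: ab modes_def Let_def m_def)
  have "trace (Jmat (a, b) :: 'n cmat) = 0"
  proof (cases "b = 0")
    case False
    then have "\<not> ?N dvd b"
      using ab_le(2) \<open>2 * m < ?N\<close> zdvd_not_zless[of "\<bar>b\<bar>" ?N] by auto
    then have "\<not> [int (pos i) = int (pos i) + b] (mod ?N)" for i :: 'n
      by (simp add: cong_iff_dvd_diff)
    then show ?thesis by (simp add: trace_def Jmat_nth[OF odd])
  next
    case True
    with ab_le have "a \<noteq> 0" by simp
    then have "\<not> ?N dvd a"
      using ab_le(1) \<open>2 * m < ?N\<close> zdvd_not_zless[of "\<bar>a\<bar>" ?N] by auto
    then have ne: "omega CARD('n) powi a \<noteq> 1"
      using omega_powi_eq_1_iff[OF odd] by simp
    have "trace (Jmat (a, b) :: 'n cmat) = (\<Sum>i\<in>(UNIV :: 'n set). (omega CARD('n) powi a) ^ (pos i - 1))"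
    proof -
      have "omega CARD('n) powi (a * (int (pos i) - 1)) = (omega CARD('n) powi a) ^ (pos i - 1)" for i :: 'n
        using pos_ge_1[of i] by (simp add: power_int_mult flip: power_int_of_nat)
      then show ?thesis by (simp add: trace_def Jmat_nth[OF odd] True)
    qed
    also have "\<dots> = (\<Sum>k\<in>{1..CARD('n)}. (omega CARD('n) powi a) ^ (k - 1))"
      by (rule sum.reindex_bij_betw[OF bij_betw_pos])
    also have "\<dots> = (\<Sum>k<CARD('n). (omega CARD('n) powi a) ^ k)"
      by (rule sum.reindex_bij_witness[of _ Suc "\<lambda>k. k - 1"]) auto
    also have "\<dots> = ((omega CARD('n) powi a) ^ CARD('n) - 1) / (omega CARD('n) powi a - 1)"
      using ne by (rule geometric_sum)
    also have "(omega CARD('n) powi a) ^ CARD('n) = 1"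
      using omega_powi_eq_1_iff[OF odd, of "a * ?N"] by (simp add: power_int_mult)
    finally show ?thesis by simp
  qed
  then show ?thesis by (simp add: Lmat_def trace_cscale ab)
qed

lemma sum_cscale_nth: "(\<Sum>k\<in>A. c k *\<^sub>C X k) $ i $ j = (\<Sum>k\<in>A. c k * X k $ i $ j)"
  by simp

text \<open>The entries displaced by \<open>b0\<close> see only the modes with second component
  \<open>b0\<close>. Along these entries the coefficients, multiplied by nonzero phases, have
  vanishing power sums at the distinct nodes \<open>?w powi a\<close>, so Vandermonde applies
  again.\<close>

lemma Lmat_independent:
  assumes odd: "odd CARD('n::{finite,linorder})"
    and sum0: "(\<Sum>k\<in>all_modes CARD('n). c k *\<^sub>C (Lmat k :: 'n cmat)) = 0"
    and k: "k \<in> all_modes CARD('n)"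
  shows "c k = 0"
proof -
  let ?N = "int CARD('n)" and ?w = "omega CARD('n)"
  define m where "m = (?N - 1) div 2"
  have N: "2 * m + 1 = ?N" using odd by (auto simp: m_def elim: oddE)
  obtain a0 b0 where k0: "k = (a0, b0)" by (cases k)
  have modes: "all_modes CARD('n) = {-m..m} \<times> {-m..m}"
    by (simp add: all_modes_def m_def Let_def)
  have a0: "a0 \<in> {-m..m}" and b0: "b0 \<in> {-m..m}" using k by (auto simp: modes k0)
  have small: "x = y" if "x \<in> {-m..m}" "y \<in> {-m..m}" "?N dvd x - y" for x y
    using that N zdvd_not_zless[of "\<bar>x - y\<bar>" ?N] by fastforce
  let ?y = "\<lambda>a. c (a, b0) * ?w powi (half CARD('n) * a * b0)"
  have "?y a0 = 0"
  proof (rule power_sums_eq_0_imp_eq_0[of "{-m..m}" "\<lambda>a. ?w powi a" ?y])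
    show "inj_on (\<lambda>a. ?w powi a) {-m..m}"
      using small by (intro inj_onI) (simp add: omega_powi_eq_iff[OF odd])
    fix l assume "l < card {-m..m}"
    then have "l < CARD('n)" using N by simp
    \<comment> \<open>The row of rank \<open>l + 1\<close> carries the exponent
      \<open>a * l\<close>, that is, the \<open>l\<close>-th power of the node.\<close>
    then obtain i :: 'n where i: "pos i = Suc l" using ex_pos_eq[of "Suc l", where 'n = 'n] by auto
    obtain j :: 'n where j: "[int (pos j) = int (pos i) + b0] (mod ?N)"
      using ex1_pos_cong by blast
    have cond: "[int (pos j) = int (pos i) + b] (mod ?N) \<longleftrightarrow> b = b0" if "b \<in> {-m..m}" for b
    proof
      assume "[int (pos j) = int (pos i) + b] (mod ?N)"
      then have "[int (pos i) + b = int (pos i) + b0] (mod ?N)"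
        using j by (simp add: cong_def)
      then have "?N dvd b - b0" by (simp add: cong_iff_dvd_diff)
      then show "b = b0" using small that b0 by blast
    qed (use j in simp)
    have "0 = (\<Sum>k\<in>all_modes CARD('n). c k *\<^sub>C (Lmat k :: 'n cmat)) $ i $ j"
      by (simp add: sum0)
    also have "\<dots> = (\<Sum>a\<in>{-m..m}. \<Sum>b\<in>{-m..m}. c (a, b) * (Lmat (a, b) :: 'n cmat) $ i $ j)"
      unfolding sum_cscale_nth modes by (simp only: sum.cartesian_product) (simp add: case_prod_beta)
    also have "\<dots> = (\<Sum>a\<in>{-m..m}. \<Sum>b\<in>{-m..m}. if b = b0 then
        of_nat CARD('n) / (4 * pi * \<i>) * (?y a * (?w powi a) ^ l) else 0)"
    proof (intro sum.cong refl)
      fix a b assume "b \<in> {-m..m}"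
      show "c (a, b) * (Lmat (a, b) :: 'n cmat) $ i $ j =
          (if b = b0 then of_nat CARD('n) / (4 * pi * \<i>) * (?y a * (?w powi a) ^ l) else 0)"
        unfolding Lmat_def cscale_nth Jmat_nth[OF odd] cond[OF \<open>b \<in> {-m..m}\<close>]
        by (simp add: i power_int_add power_int_mult)
    qed
    also have "\<dots> = of_nat CARD('n) / (4 * pi * \<i>) * (\<Sum>a\<in>{-m..m}. ?y a * (?w powi a) ^ l)"
      using b0 by (simp add: sum_distrib_left)
    finally show "(\<Sum>a\<in>{-m..m}. ?y a * (?w powi a) ^ l) = 0" by simp
  qed (use a0 in auto)
  then show ?thesis by (simp add: k0)
qed

text \<open>Dimension count: the N^2 coefficients are arranged as a matrix through the bijection
  \<open>\<tau>\<close>, so that the expansion becomes a linear endomorphism of the matrix space,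
  which is surjective once it is injective.\<close>

lemma ex_Lmat_expansion:
  fixes \<Omega> :: "'n::{finite,linorder} cmat"
  assumes odd: "odd CARD('n)"
  shows "\<exists>c. \<Omega> = (\<Sum>k\<in>all_modes CARD('n). c k *\<^sub>C Lmat k)"
proof -
  let ?N = "int CARD('n)"
  define m where "m = (?N - 1) div 2"
  have N: "2 * m + 1 = ?N" using odd by (auto simp: m_def elim: oddE)
  have modes: "all_modes CARD('n) = {-m..m} \<times> {-m..m}"
    by (simp add: all_modes_def m_def Let_def)
  have "card {-m..m} = CARD('n)" using N by simp
  then obtain \<tau> :: "int \<Rightarrow> 'n" where \<tau>: "bij_betw \<tau> {-m..m} UNIV"
    using finite_same_card_bij[of "{-m..m}" "UNIV :: 'n set"] by auto
  define \<Phi> where "\<Phi> C = (\<Sum>k\<in>all_modes CARD('n). C $ \<tau> (fst k) $ \<tau> (snd k) *\<^sub>C (Lmat k :: 'n cmat))"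
    for C :: "'n cmat"
  have lin: "linear \<Phi>"
    by (rule linearI)
       (simp_all add: \<Phi>_def vec_eq_iff sum.distrib algebra_simps scaleR_sum_right)
  have "C = 0" if "\<Phi> C = 0" for C
  proof -
    have "C $ i $ j = 0" for i j
    proof -
      obtain a b where "a \<in> {-m..m}" "b \<in> {-m..m}" "\<tau> a = i" "\<tau> b = j"
        using \<tau> unfolding bij_betw_def by (metis UNIV_I image_iff)
      then show ?thesis
        using Lmat_independent[OF odd that[unfolded \<Phi>_def], of "(a, b)"] by (simp add: modes)
    qed
    then show ?thesis by (simp add: vec_eq_iff)
  qed
  then have "surj \<Phi>"
    using linear_injective_imp_surjective[OF lin] linear_injective_0[OF lin] by blast
  then obtain C where "\<Omega> = \<Phi> C" by (metis surjD)
  then show ?thesis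
    unfolding \<Phi>_def by (rule exI[of _ "\<lambda>k. C $ \<tau> (fst k) $ \<tau> (snd k)"])
qed

section \<open>Coefficients of traceless matrices\<close>

lemma trace_sum: "trace (sum f A) = (\<Sum>x\<in>A. trace (f x))"
  by (simp add: trace_def sum.swap[of _ A])

lemma zero_notin_modes: "(0, 0) \<notin> modes N"
  by (simp add: modes_def Let_def)

lemma all_modes_insert: "N > 0 \<Longrightarrow> all_modes N = insert (0, 0) (modes N)"
  by (auto simp: modes_def all_modes_def Let_def)

lemma Lmat_expansion_traceless:
  fixes \<Omega> :: "'n::{finite,linorder} cmat"
  assumes odd: "odd CARD('n)" and tr: "trace \<Omega> = 0"
  shows "\<exists>c. (\<forall>k. k \<notin> modes CARD('n) \<longrightarrow> c k = 0) \<and> \<Omega> = (\<Sum>k\<in>modes CARD('n). c k *\<^sub>C Lmat k)"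
proof -
  obtain c where "\<Omega> = (\<Sum>k\<in>all_modes CARD('n). c k *\<^sub>C Lmat k)"
    using ex_Lmat_expansion[OF odd] by blast
  also have "\<dots> = c (0, 0) *\<^sub>C Lmat (0, 0) + (\<Sum>k\<in>modes CARD('n). c k *\<^sub>C Lmat k)"
    by (simp add: all_modes_insert zero_notin_modes)
  finally have \<Omega>: "\<Omega> = c (0, 0) *\<^sub>C Lmat (0, 0) + (\<Sum>k\<in>modes CARD('n). c k *\<^sub>C Lmat k)" .
  have "trace (Lmat (0, 0) :: 'n cmat) \<noteq> 0"
    by (simp add: Lmat_def trace_cscale trace_def Jmat_nth[OF odd])
  moreover have "trace \<Omega> = c (0, 0) * trace (Lmat (0, 0) :: 'n cmat)"
    by (subst \<Omega>) (simp add: trace_add trace_sum trace_cscale trace_Lmat[OF odd])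
  ultimately have "c (0, 0) = 0" using tr by simp
  then have "\<Omega> = (\<Sum>k\<in>modes CARD('n). c k *\<^sub>C Lmat k)"
    using \<Omega> by (simp add: cscale_def map_matrix_def vec_eq_iff)
  also have "\<dots> = (\<Sum>k\<in>modes CARD('n). (if k \<in> modes CARD('n) then c k else 0) *\<^sub>C Lmat k)"
    by (rule sum.cong) auto
  finally show ?thesis
    by (intro exI[of _ "\<lambda>k. if k \<in> modes CARD('n) then c k else 0"]) simp
qed

text \<open>This is what gives \<open>coef\<close> its meaning as a definite description:
  independence fixes the values on \<open>modes\<close>, and the support condition fixes them
  elsewhere.\<close>

lemma coef_sum:
  assumes odd: "odd CARD('n::{finite,linorder})" and c: "\<And>k. k \<notin> modes CARD('n) \<Longrightarrow> c k = 0"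
  shows "coef (\<Sum>k\<in>modes CARD('n). c k *\<^sub>C (Lmat k :: 'n cmat)) = c"
  unfolding coef_def
proof (rule the_equality)
  fix c' assume c': "(\<forall>k. k \<notin> modes CARD('n) \<longrightarrow> c' k = 0) \<and>
    (\<Sum>k\<in>modes CARD('n). c k *\<^sub>C (Lmat k :: 'n cmat)) = (\<Sum>k\<in>modes CARD('n). c' k *\<^sub>C Lmat k)"
  have "(\<Sum>k\<in>all_modes CARD('n). (c' k - c k) *\<^sub>C (Lmat k :: 'n cmat))
      = (\<Sum>k\<in>modes CARD('n). (c' k - c k) *\<^sub>C Lmat k)"
    using c c' by (intro sum.mono_neutral_right) (auto simp: modes_eq all_modes_def Let_def cscale_def map_matrix_def vec_eq_iff)
  also have "\<dots> = (\<Sum>k\<in>modes CARD('n). c' k *\<^sub>C Lmat k) - (\<Sum>k\<in>modes CARD('n). c k *\<^sub>C Lmat k)"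
    by (simp add: vec_eq_iff sum_subtractf left_diff_distrib)
  also have "\<dots> = 0" using c' by simp
  finally have "(\<Sum>k\<in>all_modes CARD('n). (c' k - c k) *\<^sub>C (Lmat k :: 'n cmat)) = 0" .
  then have "c' k - c k = 0" if "k \<in> all_modes CARD('n)" for k
    by (rule Lmat_independent[OF odd _ that])
  moreover have "k \<in> all_modes CARD('n)" if "k \<in> modes CARD('n)" for k
    using that by (simp add: modes_eq)
  ultimately have "c' k = c k" for k
    using c[of k] c'[THEN conjunct1, rule_format, of k] by (cases "k \<in> modes CARD('n)") simp_all
  then show "c' = c" ..
qed (use c in auto)

lemma coef_expansion:
  fixes \<Omega> :: "'n::{finite,linorder} cmat"
  assumes "odd CARD('n)" "trace \<Omega> = 0"
  shows "(\<Sum>k\<in>modes CARD('n). coef \<Omega> k *\<^sub>C Lmat k) = \<Omega>"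
    and "k \<notin> modes CARD('n) \<Longrightarrow> coef \<Omega> k = 0"
proof -
  obtain c where c: "\<And>k. k \<notin> modes CARD('n) \<Longrightarrow> c k = 0"
    and \<Omega>: "\<Omega> = (\<Sum>k\<in>modes CARD('n). c k *\<^sub>C Lmat k)"
    using Lmat_expansion_traceless[OF assms] by blast
  have "coef \<Omega> = c" unfolding \<Omega> by (rule coef_sum[OF assms(1) c])
  then show "(\<Sum>k\<in>modes CARD('n). coef \<Omega> k *\<^sub>C Lmat k) = \<Omega>"
    and "k \<notin> modes CARD('n) \<Longrightarrow> coef \<Omega> k = 0"
    using c \<Omega> by auto
qed

lemma coef_eqI:
  fixes \<Omega> :: "'n::{finite,linorder} cmat"
  assumes "odd CARD('n)" "\<And>k. k \<notin> modes CARD('n) \<Longrightarrow> c k = 0"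
    and "\<Omega> = (\<Sum>k\<in>modes CARD('n). c k *\<^sub>C Lmat k)"
  shows "coef \<Omega> = c"
  using coef_sum[OF assms(1,2)] assms(3) by simp

section \<open>The fluxes are odd under transposition\<close>

lemma trace_su: "A \<in> su \<Longrightarrow> trace A = 0"
  by (simp add: su_def)

lemma add_in_su: "A \<in> su \<Longrightarrow> B \<in> su \<Longrightarrow> A + B \<in> su"
  by (simp add: su_iff trace_add)

lemma scaleR_in_su: "A \<in> su \<Longrightarrow> t *\<^sub>R A \<in> su"
  unfolding su_iff by (simp add: trace_def scaleR_sum_right[symmetric])

lemma comm_in_su:
  assumes "A \<in> su" "B \<in> su"
  shows "comm A B \<in> su"
proof -
  have AB: "hconj A = - A" "hconj B = - B" using assms by (auto simp: su_def)
  have neg: "(- X) ** (- Y) = X ** Y" for X Y :: "'a cmat"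
    by (simp add: vec_eq_iff matrix_matrix_mult_def)
  have "hconj (comm A B) = hconj (A ** B) - hconj (B ** A)"
    by (simp add: comm_def vec_eq_iff transpose_def)
  also have "\<dots> = B ** A - A ** B"
    by (simp add: hconj_mult AB neg)
  finally have "hconj (comm A B) = - comm A B"
    by (simp add: comm_def)
  moreover have "trace (comm A B) = 0"
    by (simp add: comm_def trace_sub trace_mul_sym[of A B])
  ultimately show ?thesis by (simp add: su_def)
qed

lemma coef_transpose:
  fixes \<Omega> :: "'n::{finite,linorder} cmat"
  assumes odd: "odd CARD('n)" and tr: "trace \<Omega> = 0"
  shows "coef (transpose \<Omega>) = (\<lambda>k. coef \<Omega> (flip k))"
proof (rule coef_eqI[OF odd])
  have "transpose \<Omega> = transpose (\<Sum>k\<in>modes CARD('n). coef \<Omega> k *\<^sub>C Lmat k)"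
    by (simp add: coef_expansion[OF odd tr])
  also have "\<dots> = (\<Sum>k\<in>modes CARD('n). coef \<Omega> k *\<^sub>C transpose (Lmat k))"
    by (simp add: vec_eq_iff transpose_def)
  also have "\<dots> = (\<Sum>k\<in>modes CARD('n). coef \<Omega> (flip (flip k)) *\<^sub>C Lmat (flip k))"
    by (simp add: transpose_Lmat[OF odd])
  also have "\<dots> = (\<Sum>k\<in>modes CARD('n). coef \<Omega> (flip k) *\<^sub>C Lmat k)"
    by (rule sum_modes_flip)
  finally show "transpose \<Omega> = (\<Sum>k\<in>modes CARD('n). coef \<Omega> (flip k) *\<^sub>C Lmat k)" .
qed (simp add: coef_expansion[OF odd tr])

lemma coef_add:
  fixes A B :: "'n::{finite,linorder} cmat"
  assumes odd: "odd CARD('n)" and tr: "trace A = 0" "trace B = 0"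
  shows "coef (A + B) = (\<lambda>k. coef A k + coef B k)"
proof (rule coef_eqI[OF odd])
  have "A + B = (\<Sum>k\<in>modes CARD('n). coef A k *\<^sub>C Lmat k) + (\<Sum>k\<in>modes CARD('n). coef B k *\<^sub>C Lmat k)"
    by (simp add: coef_expansion[OF odd] tr)
  then show "A + B = (\<Sum>k\<in>modes CARD('n). (coef A k + coef B k) *\<^sub>C Lmat k)"
    by (simp add: vec_eq_iff distrib_right sum.distrib)
qed (simp add: coef_expansion[OF odd] tr)

lemma coef_scaleR:
  fixes A :: "'n::{finite,linorder} cmat"
  assumes odd: "odd CARD('n)" and tr: "trace A = 0"
  shows "coef (t *\<^sub>R A) = (\<lambda>k. t *\<^sub>R coef A k)"
proof (rule coef_eqI[OF odd])
  have "t *\<^sub>R A = t *\<^sub>R (\<Sum>k\<in>modes CARD('n). coef A k *\<^sub>C Lmat k)"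
    by (simp add: coef_expansion[OF odd tr])
  then show "t *\<^sub>R A = (\<Sum>k\<in>modes CARD('n). (t *\<^sub>R coef A k) *\<^sub>C Lmat k)"
    by (simp add: vec_eq_iff scaleR_sum_right)
qed (simp add: coef_expansion[OF odd tr])

lemma hconj_sum_Lmat:
  assumes odd: "odd CARD('n::{finite,linorder})"
  shows "hconj (\<Sum>k\<in>modes CARD('n). c k *\<^sub>C (Lmat k :: 'n cmat)) =
    - (\<Sum>k\<in>modes CARD('n). cnj (c (- k)) *\<^sub>C Lmat k)"
proof -
  have "hconj (\<Sum>k\<in>modes CARD('n). c k *\<^sub>C (Lmat k :: 'n cmat)) =
      (\<Sum>k\<in>modes CARD('n). cnj (c k) *\<^sub>C hconj (Lmat k))"
    by (simp add: vec_eq_iff transpose_def)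
  also have "\<dots> = (\<Sum>k\<in>modes CARD('n). - (cnj (c (- (- k))) *\<^sub>C Lmat (- k)))"
    by (simp add: hconj_Lmat[OF odd] vec_eq_iff)
  also have "\<dots> = (\<Sum>k\<in>modes CARD('n). - (cnj (c (- k)) *\<^sub>C Lmat k))"
    by (rule sum_modes_uminus)
  finally show ?thesis by (simp add: sum_negf)
qed

lemma trace_sum_Lmat:
  assumes odd: "odd CARD('n::{finite,linorder})"
  shows "trace (\<Sum>k\<in>modes CARD('n). c k *\<^sub>C (Lmat k :: 'n cmat)) = 0"
  by (simp add: trace_sum trace_cscale trace_Lmat[OF odd])

text \<open>The reality condition of Fourier coefficients: conjugate transposition reflects the
  modes, and comparing coefficients turns skewness into a symmetry under that reflection.\<close>

lemma sum_Lmat_in_su_iff: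
  assumes odd: "odd CARD('n::{finite,linorder})" and c: "\<And>k. k \<notin> modes CARD('n) \<Longrightarrow> c k = 0"
  shows "(\<Sum>k\<in>modes CARD('n). c k *\<^sub>C (Lmat k :: 'n cmat)) \<in> su \<longleftrightarrow> (\<forall>k. cnj (c (- k)) = c k)"
proof -
  have c': "coef (\<Sum>k\<in>modes CARD('n). cnj (c (- k)) *\<^sub>C (Lmat k :: 'n cmat)) = (\<lambda>k. cnj (c (- k)))"
    using c by (intro coef_sum[OF odd]) simp
  have "(\<Sum>k\<in>modes CARD('n). c k *\<^sub>C (Lmat k :: 'n cmat)) \<in> su \<longleftrightarrow>
      (\<Sum>k\<in>modes CARD('n). cnj (c (- k)) *\<^sub>C (Lmat k :: 'n cmat)) = (\<Sum>k\<in>modes CARD('n). c k *\<^sub>C Lmat k)"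
    unfolding su_def mem_Collect_eq hconj_sum_Lmat[OF odd] trace_sum_Lmat[OF odd] by simp
  also have "\<dots> \<longleftrightarrow> (\<forall>k. cnj (c (- k)) = c k)"
  proof
    assume "(\<Sum>k\<in>modes CARD('n). cnj (c (- k)) *\<^sub>C (Lmat k :: 'n cmat)) = (\<Sum>k\<in>modes CARD('n). c k *\<^sub>C Lmat k)"
    then have "(\<lambda>k. cnj (c (- k))) = c"
      using coef_sum[OF odd, of c] c c' by simp
    then show "\<forall>k. cnj (c (- k)) = c k" by (metis (no_types))
  qed (simp only:)
  finally show ?thesis .
qed

section \<open>The operator A and the stream function\<close>

lemma coef_Aop:
  fixes \<Omega> :: "'n::{finite,linorder} cmat"
  assumes odd: "odd CARD('n)" and tr: "trace \<Omega> = 0"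
  shows "coef (Aop \<Omega>) = (\<lambda>k. of_real ((wavenumber k)\<^sup>2) * coef \<Omega> k)"
  unfolding Aop_def by (rule coef_sum[OF odd]) (simp add: coef_expansion[OF odd tr])

lemma coef_inject:
  fixes A B :: "'n::{finite,linorder} cmat"
  assumes "odd CARD('n)" "trace A = 0" "trace B = 0" "coef A = coef B"
  shows "A = B"
proof -
  have "A = (\<Sum>k\<in>modes CARD('n). coef A k *\<^sub>C Lmat k)"
    by (rule coef_expansion(1)[OF assms(1,2), symmetric])
  also have "\<dots> = B"
    unfolding assms(4) by (rule coef_expansion(1)[OF assms(1,3)])
  finally show ?thesis .
qed

lemma inj_on_Aop:
  assumes odd: "odd CARD('n::{finite,linorder})"
  shows "inj_on Aop (su :: 'n cmat set)"
proof (rule inj_onI)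
  fix A B :: "'n cmat" assume A: "A \<in> su" and B: "B \<in> su" and eq: "Aop A = Aop B"
  have tr: "trace A = 0" "trace B = 0" using A B by (simp_all add: trace_su)
  have "coef A k = coef B k" for k
  proof (cases "k \<in> modes CARD('n)")
    case True
    have "of_real ((wavenumber k)\<^sup>2) * coef A k = of_real ((wavenumber k)\<^sup>2) * coef B k"
      using fun_cong[OF arg_cong[OF eq, of coef], of k] by (simp only: coef_Aop[OF odd] tr)
    then show ?thesis using wavenumber_pos[OF True] by simp
  qed (simp add: coef_expansion[OF odd] tr)
  then show "A = B" by (intro coef_inject[OF odd tr]) auto
qed

text \<open>The preimage divides each coefficient by the squared wavenumber. This weight is real and
  even, so the reality condition survives and the preimage stays in \<open>su\<close>.\<close>

lemma Aop_surj_su: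
  fixes \<Omega> :: "'n::{finite,linorder} cmat"
  assumes odd: "odd CARD('n)" and \<Omega>: "\<Omega> \<in> su"
  shows "\<Omega> \<in> Aop ` su"
proof
  note tr = trace_su[OF \<Omega>]
  let ?c = "\<lambda>k. coef \<Omega> k / of_real ((wavenumber k)\<^sup>2)"
  let ?Y = "\<Sum>k\<in>modes CARD('n). ?c k *\<^sub>C (Lmat k :: 'n cmat)"
  have c0: "?c k = 0" if "k \<notin> modes CARD('n)" for k
    using that by (simp add: coef_expansion[OF odd tr])
  have "(\<Sum>k\<in>modes CARD('n). coef \<Omega> k *\<^sub>C (Lmat k :: 'n cmat)) \<in> su"
    by (simp add: coef_expansion[OF odd tr] \<Omega>)
  then have "cnj (coef \<Omega> (- k)) = coef \<Omega> k" for k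
    using sum_Lmat_in_su_iff[OF odd, of "coef \<Omega>"] coef_expansion(2)[OF odd tr] by blast
  then have "cnj (?c (- k)) = ?c k" for k by simp
  then show "?Y \<in> su"
    using sum_Lmat_in_su_iff[OF odd, of ?c] c0 by blast
  have cY: "coef ?Y = ?c" by (rule coef_sum[OF odd c0])
  show "\<Omega> = Aop ?Y"
  proof (rule coef_inject[OF odd tr])
    show "trace (Aop ?Y) = 0" by (simp add: Aop_def trace_sum_Lmat[OF odd])
    show "coef \<Omega> = coef (Aop ?Y)"
    proof
      fix k
      show "coef \<Omega> k = coef (Aop ?Y) k"
      proof (cases "k \<in> modes CARD('n)")
        case True
        then show ?thesis
          unfolding coef_Aop[OF odd trace_sum_Lmat[OF odd]] cY using wavenumber_pos[OF True] by simp
      next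
        case False
        then show ?thesis
          unfolding coef_Aop[OF odd trace_sum_Lmat[OF odd]] cY by (simp add: coef_expansion[OF odd tr])
      qed
    qed
  qed
qed

lemma Aop_transpose:
  fixes \<Omega> :: "'n::{finite,linorder} cmat"
  assumes odd: "odd CARD('n)" and tr: "trace \<Omega> = 0"
  shows "Aop (transpose \<Omega>) = transpose (Aop \<Omega>)"
proof (rule coef_inject[OF odd])
  have tr': "trace (Aop \<Omega>) = 0" by (simp add: Aop_def trace_sum_Lmat[OF odd])
  show "trace (Aop (transpose \<Omega>)) = 0" by (simp add: Aop_def trace_sum_Lmat[OF odd])
  show "trace (transpose (Aop \<Omega>)) = 0" by (simp add: tr')
  show "coef (Aop (transpose \<Omega>)) = coef (transpose (Aop \<Omega>))"
    by (simp add: coef_Aop coef_transpose odd tr tr')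
qed

lemma stream_in_su:
  fixes \<Omega> :: "'n::{finite,linorder} cmat"
  assumes "odd CARD('n)" "\<Omega> \<in> su"
  shows "stream \<Omega> \<in> su"
  unfolding stream_def by (intro uminus_in_su inv_into_into Aop_surj_su assms)

lemma stream_transpose:
  fixes \<Omega> :: "'n::{finite,linorder} cmat"
  assumes odd: "odd CARD('n)" and \<Omega>: "\<Omega> \<in> su"
  shows "stream (transpose \<Omega>) = transpose (stream \<Omega>)"
proof -
  let ?Y = "inv_into su Aop \<Omega>"
  have Y: "?Y \<in> su" "Aop ?Y = \<Omega>"
    using Aop_surj_su[OF assms] by (auto intro: inv_into_into f_inv_into_f)
  have "Aop (transpose ?Y) = transpose \<Omega>"
    using Aop_transpose[OF odd trace_su[OF Y(1)]] by (simp add: Y(2))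
  then have "inv_into su Aop (transpose \<Omega>) = transpose ?Y"
    by (intro inv_into_f_eq inj_on_Aop odd transpose_in_su Y(1))
  then show ?thesis by (simp add: stream_def transpose_minus)
qed

text \<open>The line through \<open>\<Omega>\<close> in direction \<open>v\<close> stays inside
  \<open>su\<close>; restricting to it reduces the claim to uniqueness of derivatives in one real
  variable.\<close>

lemma has_derivative_within_su_unique:
  assumes f: "(F has_derivative f) (at \<Omega> within su)" and g: "(F has_derivative g) (at \<Omega> within su)"
    and "\<Omega> \<in> su" "v \<in> su"
  shows "f v = g v"
proof -
  let ?l = "\<lambda>t::real. \<Omega> + t *\<^sub>R v"
  have sub: "range ?l \<subseteq> su" using assms(3,4) by (auto intro: add_in_su scaleR_in_su)
  have l: "(?l has_derivative (\<lambda>t. t *\<^sub>R v)) (at 0)"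
    by (auto intro!: derivative_eq_intros)
  have deriv: "((\<lambda>t. F (?l t)) has_derivative (\<lambda>t. h (t *\<^sub>R v))) (at 0)"
    if "(F has_derivative h) (at \<Omega> within su)" for h
  proof (rule has_derivative_in_compose[OF l])
    show "(F has_derivative h) (at (?l 0) within range ?l)"
      using has_derivative_subset[OF that sub] by simp
  qed
  have "(\<lambda>t. f (t *\<^sub>R v)) = (\<lambda>t. g (t *\<^sub>R v))"
    by (rule has_derivative_unique[OF deriv[OF f] deriv[OF g]])
  from fun_cong[OF this, of 1] show ?thesis by simp
qed

text \<open>By the chain rule the transposed derivative is one more derivative of \<open>F\<close>
  at \<open>\<Omega>\<close> within \<open>su\<close>. It need not be the one chosen by
  \<open>frechet_derivative\<close>, but both agree on \<open>su\<close>.\<close>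

lemma frechet_derivative_transpose:
  fixes F :: "'n::finite cmat \<Rightarrow> real"
  assumes sym: "\<And>A. A \<in> su \<Longrightarrow> F (transpose A) = F A"
    and diff: "\<And>A. A \<in> su \<Longrightarrow> F differentiable (at A within su)"
    and \<Omega>: "\<Omega> \<in> su" and v: "v \<in> su"
  shows "frechet_derivative F (at (transpose \<Omega>) within su) (transpose v) =
    frechet_derivative F (at \<Omega> within su) v"
proof -
  let ?f = "frechet_derivative F (at (transpose \<Omega>) within su)"
  have "(F has_derivative ?f) (at (transpose \<Omega>) within su)"
    using diff[OF transpose_in_su[OF \<Omega>]] by (simp add: frechet_derivative_works)
  then have "(F has_derivative ?f) (at (transpose \<Omega>) within transpose ` su)"
    by (rule has_derivative_subset) (auto intro: transpose_in_su)
  then have "((\<lambda>A. F (transpose A)) has_derivative (\<lambda>v. ?f (transpose v))) (at \<Omega> within su)"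
    by (rule has_derivative_in_compose[OF bounded_linear_imp_has_derivative[OF bounded_linear_transpose]])
  then have "(F has_derivative (\<lambda>v. ?f (transpose v))) (at \<Omega> within su)"
    by (rule has_derivative_transform[OF \<Omega>, rotated]) (simp add: sym)
  then show ?thesis
    using diff[OF \<Omega>] \<Omega> v unfolding frechet_derivative_works
    by (rule has_derivative_within_su_unique)
qed

text \<open>A common form for both truncated quantities: the factor 1/2, the cutoff and the division
  by the squared wavenumber go into the weight, and only the invariance of the weight under
  \<open>flip\<close> matters for the symmetry.\<close>

definition spectral :: "(int \<times> int \<Rightarrow> real) \<Rightarrow> 'n::{finite,linorder} cmat \<Rightarrow> real" where
  "spectral w \<Omega> = (\<Sum>k\<in>modes CARD('n). w k * (cmod (coef \<Omega> k))\<^sup>2)"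

lemma energy_eq_spectral:
  "energy K = spectral (\<lambda>k. if wavenumber k \<le> K then 1 / (2 * (wavenumber k)\<^sup>2) else 0)"
  by (rule ext) (simp add: energy_def spectral_def sum.inter_filter[symmetric] sum_distrib_left if_distrib if_distribR cong: if_cong)

lemma enstrophy_eq_spectral:
  "enstrophy K = spectral (\<lambda>k. if wavenumber k \<le> K then 1 / 2 else 0)"
  by (rule ext) (simp add: enstrophy_def spectral_def sum.inter_filter[symmetric] sum_distrib_left if_distrib if_distribR cong: if_cong)

lemma spectral_transpose:
  fixes \<Omega> :: "'n::{finite,linorder} cmat"
  assumes odd: "odd CARD('n)" and w: "\<And>k. w (flip k) = w k" and "\<Omega> \<in> su"
  shows "spectral w (transpose \<Omega>) = spectral w \<Omega>"
proof -
  have "spectral w (transpose \<Omega>) = (\<Sum>k\<in>modes CARD('n). w (flip k) * (cmod (coef \<Omega> (flip k)))\<^sup>2)"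
    using assms by (simp add: spectral_def coef_transpose trace_su)
  also have "\<dots> = spectral w \<Omega>"
    unfolding spectral_def by (rule sum_modes_flip)
  finally show ?thesis .
qed

text \<open>\<open>coef\<close> is a definite description and is controlled only on traceless
  matrices. Composing it with the projection \<open>p\<close> that removes the trace gives a map
  that is linear everywhere and unchanged on \<open>su\<close>.\<close>

lemma coef_linear_on_su:
  assumes odd: "odd CARD('n::{finite,linorder})"
  shows "\<exists>l. bounded_linear l \<and> (\<forall>\<Omega> \<in> (su :: 'n cmat set). l \<Omega> = coef \<Omega> k)"
proof (intro exI conjI ballI)
  define p where "p \<Omega> = \<Omega> - (trace \<Omega> / of_nat CARD('n)) *\<^sub>C mat 1" for \<Omega> :: "'n cmat"
  have tr: "trace (p \<Omega>) = 0" for \<Omega>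
    by (simp add: p_def trace_sub trace_cscale trace_I)
  have p_add: "p (A + B) = p A + p B" for A B
    by (simp add: p_def vec_eq_iff trace_add algebra_simps add_divide_distrib)
  have "trace (t *\<^sub>R A) = t *\<^sub>R trace A" for t and A :: "'n cmat"
    by (simp add: trace_def scaleR_sum_right)
  then have p_scaleR: "p (t *\<^sub>R A) = t *\<^sub>R p A" for t A
    by (simp add: p_def vec_eq_iff scaleR_conv_of_real[where 'a = complex] algebra_simps)
  show "bounded_linear (\<lambda>\<Omega>. coef (p \<Omega>) k)"
    unfolding linear_conv_bounded_linear[symmetric]
    by (rule linearI) (simp_all add: p_add p_scaleR coef_add[OF odd tr tr] coef_scaleR[OF odd tr])
  show "coef (p \<Omega>) k = coef \<Omega> k" if "\<Omega> \<in> su" for \<Omega>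
  proof -
    have "p \<Omega> = \<Omega>" by (simp add: p_def trace_su[OF that] vec_eq_iff)
    then show ?thesis by simp
  qed
qed

lemma spectral_differentiable:
  fixes \<Omega> :: "'n::{finite,linorder} cmat"
  assumes odd: "odd CARD('n)" and \<Omega>: "\<Omega> \<in> su"
  shows "spectral w differentiable (at \<Omega> within su)"
proof -
  obtain l where l: "\<And>k. bounded_linear (l k)" "\<And>k A. A \<in> (su :: 'n cmat set) \<Longrightarrow> l k A = coef A k"
    using coef_linear_on_su[OF odd] by metis
  have "((\<lambda>A. \<Sum>k\<in>modes CARD('n). w k * (l k A \<bullet> l k A)) has_derivative
      (\<lambda>u. \<Sum>k\<in>modes CARD('n). w k * (l k \<Omega> \<bullet> l k u + l k u \<bullet> l k \<Omega>))) (at \<Omega> within su)"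
    by (intro has_derivative_sum has_derivative_mult_right has_derivative_inner bounded_linear_imp_has_derivative l(1))
  then have "(spectral w has_derivative
      (\<lambda>u. \<Sum>k\<in>modes CARD('n). w k * (l k \<Omega> \<bullet> l k u + l k u \<bullet> l k \<Omega>))) (at \<Omega> within su)"
    by (rule has_derivative_transform[OF \<Omega>, rotated]) (simp add: spectral_def l(2) power2_norm_eq_inner)
  then show ?thesis by (rule differentiableI)
qed

lemma spectral_flux_transpose:
  fixes \<Omega> :: "'n::{finite,linorder} cmat"
  assumes odd: "odd CARD('n)" and w: "\<And>k. w (flip k) = w k" and \<Omega>: "\<Omega> \<in> su"
  shows "frechet_derivative (spectral w) (at (transpose \<Omega>) within su)
      (comm (stream (transpose \<Omega>)) (transpose \<Omega>)) =
    - frechet_derivative (spectral w) (at \<Omega> within su) (comm (stream \<Omega>) \<Omega>)"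
proof -
  let ?v = "comm (stream \<Omega>) \<Omega>"
  have v: "?v \<in> su" by (intro comm_in_su stream_in_su odd \<Omega>)
  have "comm (stream (transpose \<Omega>)) (transpose \<Omega>) = transpose (- ?v)"
    by (simp add: stream_transpose[OF odd \<Omega>] transpose_comm transpose_minus)
  then have "frechet_derivative (spectral w) (at (transpose \<Omega>) within su)
      (comm (stream (transpose \<Omega>)) (transpose \<Omega>)) =
      frechet_derivative (spectral w) (at \<Omega> within su) (- ?v)"
    using frechet_derivative_transpose[where F = "spectral w" and \<Omega> = \<Omega> and v = "- ?v"]
      spectral_transpose[OF odd, of w] w spectral_differentiable[OF odd] \<Omega> uminus_in_su[OF v] by simp
  also have "\<dots> = - frechet_derivative (spectral w) (at \<Omega> within su) ?v"
    using linear_frechet_derivative[OF spectral_differentiable[OF odd \<Omega>]] by (rule linear_neg)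
  finally show ?thesis .
qed

lemma energy_flux_transpose:
  fixes \<Omega> :: "'n::{finite,linorder} cmat"
  assumes "odd CARD('n)" "\<Omega> \<in> su"
  shows "energy_flux K (transpose \<Omega>) = - energy_flux K \<Omega>"
  unfolding energy_flux_def energy_eq_spectral using assms by (subst spectral_flux_transpose) auto

lemma enstrophy_flux_transpose:
  fixes \<Omega> :: "'n::{finite,linorder} cmat"
  assumes "odd CARD('n)" "\<Omega> \<in> su"
  shows "enstrophy_flux K (transpose \<Omega>) = - enstrophy_flux K \<Omega>"
  unfolding enstrophy_flux_def enstrophy_eq_spectral using assms by (subst spectral_flux_transpose) auto

text \<open>Invariance makes the integral equal to its own negative. A function that is not
  measurable has Bochner integral 0 by convention, so the claim needs no regularity of
  \<open>f\<close>.\<close>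

lemma integral_eq_0_if_odd:
  fixes f :: "'a \<Rightarrow> real"
  assumes T: "T \<in> measurable M M" "distr M M T = M" and odd: "\<And>x. x \<in> space M \<Longrightarrow> f (T x) = - f x"
  shows "(\<integral>x. f x \<partial>M) = 0"
proof (cases "f \<in> borel_measurable M")
  case True
  have "(\<integral>x. f x \<partial>M) = (\<integral>x. f x \<partial>distr M M T)" by (simp add: T(2))
  also have "\<dots> = (\<integral>x. f (T x) \<partial>M)" by (rule integral_distr[OF T(1) True])
  also have "\<dots> = (\<integral>x. - f x \<partial>M)" by (intro Bochner_Integration.integral_cong refl odd)
  finally show ?thesis by simp
next
  case False
  then show ?thesis by (intro not_integrable_integral_eq) auto
qed

theorem corollary5p1:
  fixes K :: real
    and z :: "nat \<Rightarrow> complex"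
    and m :: "'n::{finite,linorder} cmat measure"
  assumes "CARD('n) \<ge> 3" and "odd CARD('n)"
    and "K > 0"
    and "z \<in> (top_of_set (moment_space CARD('n))) interior_of (regular_moments TYPE('n))"
    and "kks_normalized z m"
  shows "avg_energy_flux K m = 0 \<and> avg_enstrophy_flux K m = 0"
proof -
  obtain M where M: "kks_liouville z M" and m: "m = scale_measure (1 / emeasure M (space M)) M"
    using assms(5) by (auto simp: kks_normalized_def)
  have "z \<in> regular_moments TYPE('n)"
    by (rule subsetD[OF interior_of_subset assms(4)])
  then have regular: "card (eigenvalues A) = CARD('n)" if "A \<in> orbit z" for A :: "'n cmat"
    using that by (simp add: regular_moments_def)
  have sets: "sets m = sets (restrict_space borel (orbit z))"
    using M by (simp add: m kks_liouville_def)
  then have T: "transpose \<in> measurable m m" and T': "transpose \<in> measurable M M"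
    using M by (simp_all add: transpose_measurable kks_liouville_def)
  have space: "space m = orbit z"
    using sets_eq_imp_space_eq[OF sets] by (simp add: space_restrict_space)
  have invariant: "distr M M transpose = M"
  proof (rule distr_transpose_kks_liouville[OF M])
    fix A :: "'n cmat" assume A: "A \<in> orbit z"
    have "CARD('n) \<ge> 2" using assms(1) by simp
    then show "\<exists>U \<phi> \<phi>' S. orbit_chart z U \<phi> \<phi>' \<and> open S \<and> A \<in> S \<and> \<phi> ` U = orbit z \<inter> S"
      by (rule ex_orbit_chart[OF _ A regular[OF A]])
  qed
  \<comment> \<open>\<open>m\<close> and \<open>M\<close> have the same measurable sets; with
    \<open>M\<close> as target the normalizing factor can be pulled out of the push-forward.\<close>
  have "distr m m transpose = distr m M transpose"
    by (rule distr_cong) (simp_all add: m)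
  also have "\<dots> = scale_measure (1 / emeasure M (space M)) (distr M M transpose)"
    unfolding m by (rule distr_scale_measure[OF T'])
  also have "\<dots> = m"
    unfolding invariant by (rule m[symmetric])
  finally have distr: "distr m m transpose = m" .
  have su: "A \<in> su" if "A \<in> space m" for A
    using that by (simp add: space orbit_def)
  show ?thesis
    unfolding avg_energy_flux_def avg_enstrophy_flux_def
  proof
    show "(\<integral>\<Omega>. energy_flux K \<Omega> \<partial>m) = 0"
      by (rule integral_eq_0_if_odd[OF T distr]) (rule energy_flux_transpose[OF assms(2) su])
    show "(\<integral>\<Omega>. enstrophy_flux K \<Omega> \<partial>m) = 0"
      by (rule integral_eq_0_if_odd[OF T distr]) (rule enstrophy_flux_transpose[OF assms(2) su])
  qed
qed

end
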